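(* For every integer $k\geq 4$ and every integer $n \geq 2(k-1)!\binom{k}{4}+k-1$, every set of $n$ points in general position in the plane has at most $\binom{n}{k}$ $k$-holes; that is, the number of $k$-holes among $n$-point sets is maximized by a set of $n$ points in convex position.
   Context: A point set in the plane is in general position if no three of its points are collinear. For such a point set $S$, a $k$-gon of $S$ is a simple polygon whose vertex set consists of exactly $k$ points of $S$ (distinct simple polygons on the same vertex set count separately), and a $k$-hole of $S$ is a $k$-gon (convex or not) whose interior contains no point of $S$. A set of $n$ points in convex position has exactly $\binom{n}{k}$ $k$-holes. *)

theory Defs
  imports "HOL-Analysis.Analysis"
begin

definition general_position :: "(real ^ 2) set \<Rightarrow> bool" where
  "general_position S \<longleftrightarrow>
    (\<forall>a\<in>S. \<forall>b\<in>S. \<forall>c\<in>S. a \<noteq> b \<and> a \<noteq> c \<and> b \<noteq> c \<longrightarrow> \<not> collinear {a, b, c})"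

definition convex_position :: "(real ^ 2) set \<Rightarrow> bool" where
  "convex_position S \<longleftrightarrow> (\<forall>p\<in>S. p \<notin> convex hull (S - {p}))"

definition polygon_edge :: "(real ^ 2) list \<Rightarrow> nat \<Rightarrow> (real ^ 2) set" where
  "polygon_edge vs i = closed_segment (vs ! i) (vs ! (Suc i mod length vs))"

definition polygon_boundary :: "(real ^ 2) list \<Rightarrow> (real ^ 2) set" where
  "polygon_boundary vs = (\<Union>i<length vs. polygon_edge vs i)"

(* Two different edges meet exactly in their common endpoints: in one vertex if they are
   cyclically adjacent, and not at all otherwise. *)
definition simple_polygon :: "(real ^ 2) list \<Rightarrow> bool" where
  "simple_polygon vs \<longleftrightarrow>
    3 \<le> length vs \<and> distinct vs \<and>
    (\<forall>i<length vs. \<forall>j<length vs. i \<noteq> j \<longrightarrow>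
      polygon_edge vs i \<inter> polygon_edge vs j =
      {vs ! i, vs ! (Suc i mod length vs)} \<inter> {vs ! j, vs ! (Suc j mod length vs)})"

(* A polygon is represented by its boundary curve, so that the vertex lists that differ only in
   starting point or orientation give one polygon.  If S is in general position, no vertex is
   flat, and the curve determines the vertices and edges. *)
definition k_gons :: "nat \<Rightarrow> (real ^ 2) set \<Rightarrow> (real ^ 2) set set" where
  "k_gons k S =
    {polygon_boundary vs | vs. simple_polygon vs \<and> length vs = k \<and> set vs \<subseteq> S}"

definition k_holes :: "nat \<Rightarrow> (real ^ 2) set \<Rightarrow> (real ^ 2) set set" where
  "k_holes k S = {P \<in> k_gons k S. inside P \<inter> S = {}}"

end

theory Submission
  imports Defs "HOL-Combinatorics.Multiset_Permutations"
begin

text \<open>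
  Fix the cyclic order of \<open>k - 1\<close> points, with a gap between \<open>a\<close> and \<open>b\<close>. On each side of the
  line through \<open>a\<close> and \<open>b\<close> at most one point \<open>d\<close> can be inserted into the gap so that the result
  is a \<open>k\<close>-hole with a reflex vertex at \<open>d\<close>: if \<open>d'\<close> is another one, then one of \<open>d\<close> and \<open>d'\<close>
  lies inside the polygon through the other. A polygon without reflex vertex is convex, because its
  inside is connected and locally supported at every boundary point. Moreover, a reflex vertex \<open>d\<close>
  lies in the interior of the convex hull of the remaining vertices.

  Call a set of points bad if the interior of its convex hull contains a point of \<open>S\<close>, and let \<open>B\<close>
  be the number of bad \<open>k\<close>-subsets of \<open>S\<close>. A hole whose vertex set is bad has a reflex vertex, so
  it is determined by an ordering of a bad \<open>(k - 1)\<close>-set. There are at most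
  \<open>k B / (n - k + 1)\<close> of these sets, each with \<open>(k - 1)!\<close> orderings, only half of which can occur
  if \<open>k = 4\<close>. For the given \<open>n\<close> the number of these holes is therefore at most \<open>B\<close>. The
  remaining holes are determined by \<open>k\<close>-sets that are not bad.
\<close>

section \<open>Orientation\<close>

text \<open>Twice the signed area of the triangle \<open>p q z\<close>; positive exactly if
  \<open>z\<close> lies to the left of the line directed from \<open>p\<close> to
  \<open>q\<close>.\<close>

definition orient :: "real ^ 2 \<Rightarrow> real ^ 2 \<Rightarrow> real ^ 2 \<Rightarrow> real" where
  "orient p q z = (q $ 1 - p $ 1) * (z $ 2 - p $ 2) - (q $ 2 - p $ 2) * (z $ 1 - p $ 1)"

lemma orient_simps [simp]: "orient p q p = 0" "orient p q q = 0" "orient p p q = 0"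
  by (auto simp: orient_def algebra_simps)

lemma orient_rotate: "orient q z p = orient p q z"
  by (simp add: orient_def algebra_simps)

lemma orient_swap: "orient q p z = - orient p q z"
  by (simp add: orient_def algebra_simps)

lemma orient_affine:
  "orient p q ((1 - t) *\<^sub>R x + t *\<^sub>R y) = (1 - t) * orient p q x + t * orient p q y"
  by (simp add: orient_def algebra_simps)

lemma orient_inner:
  "orient p q z = vector [p $ 2 - q $ 2, q $ 1 - p $ 1] \<bullet> z - vector [p $ 2 - q $ 2, q $ 1 - p $ 1] \<bullet> p"
  by (simp add: orient_def inner_vec_def sum_2 algebra_simps)

lemma halfplane_gt: "convex {z. orient p q z > 0}" "open {z. orient p q z > 0}"
  by (auto simp: orient_inner convex_halfspace_gt open_halfspace_gt)

lemma halfplane_lt: "convex {z. orient p q z < 0}" "open {z. orient p q z < 0}"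
  by (auto simp: orient_inner convex_halfspace_lt open_halfspace_lt)

lemma halfplane_ge: "convex {z. orient p q z \<ge> 0}" "closed {z. orient p q z \<ge> 0}"
  by (auto simp: orient_inner convex_halfspace_ge closed_halfspace_ge)

lemma halfplane_le: "convex {z. orient p q z \<le> 0}" "closed {z. orient p q z \<le> 0}"
  by (auto simp: orient_inner convex_halfspace_le closed_halfspace_le)

lemma orient_eq_0_line:
  assumes "orient a b z = 0" "a \<noteq> b"
  obtains u where "z = (1 - u) *\<^sub>R a + u *\<^sub>R b"
proof (cases "a $ 1 = b $ 1")
  case False
  define u where "u = (z $ 1 - a $ 1) / (b $ 1 - a $ 1)"
  have u: "u * (b $ 1 - a $ 1) = z $ 1 - a $ 1" using False by (simp add: u_def)
  have "(z $ 2 - a $ 2) * (b $ 1 - a $ 1) = (u * (b $ 2 - a $ 2)) * (b $ 1 - a $ 1)"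
    using assms(1) u by (simp add: orient_def mult_ac)
  then have "z $ 2 - a $ 2 = u * (b $ 2 - a $ 2)" using False by simp
  with u have "z = (1 - u) *\<^sub>R a + u *\<^sub>R b" by (simp add: vec_eq_iff forall_2 algebra_simps)
  then show ?thesis using that by blast
next
  case True
  then have ne: "a $ 2 \<noteq> b $ 2" using assms(2) by (auto simp: vec_eq_iff forall_2)
  have z1: "z $ 1 = a $ 1" using assms(1) True ne by (simp add: orient_def)
  define u where "u = (z $ 2 - a $ 2) / (b $ 2 - a $ 2)"
  have u: "u * (b $ 2 - a $ 2) = z $ 2 - a $ 2" using ne by (simp add: u_def)
  then have "z = (1 - u) *\<^sub>R a + u *\<^sub>R b"
    using z1 True by (simp add: vec_eq_iff forall_2 algebra_simps)
  then show ?thesis using that by blast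
qed

lemma orient_eq_0_collinear: "orient a b c = 0 \<Longrightarrow> collinear {a, b, c}"
proof (cases "a = b")
  case False
  assume "orient a b c = 0"
  then obtain u where "c = (1 - u) *\<^sub>R a + u *\<^sub>R b" using False by (rule orient_eq_0_line)
  then have "collinear {a, c, b}"
    unfolding collinear_3_expand by (auto intro!: exI[of _ "1 - u"])
  then show ?thesis by (simp add: insert_commute)
qed simp

lemma general_position_orient:
  assumes "general_position S" "a \<in> S" "b \<in> S" "c \<in> S" "a \<noteq> b" "a \<noteq> c" "b \<noteq> c"
  shows "orient a b c \<noteq> 0"
  using assms orient_eq_0_collinear unfolding general_position_def by blast

text \<open>On the line through \<open>b\<close> and \<open>c\<close>, \<open>orient a b\<close>
  runs affinely from 0 at \<open>b\<close> to \<open>orient a b c\<close> at \<open>c\<close>, and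
  \<open>orient c a\<close> from that value down to 0. The two signs thus bound the parameter of
  \<open>z\<close> from both sides.\<close>

lemma triangle_edge:
  assumes "orient a b c > 0" "orient a b z \<ge> 0" "orient c a z \<ge> 0" "orient b c z = 0"
  shows "z \<in> closed_segment b c"
proof -
  have "b \<noteq> c" using assms(1) by (auto simp: orient_def)
  then obtain u where z: "z = (1 - u) *\<^sub>R b + u *\<^sub>R c" using assms(4) orient_eq_0_line by blast
  have "u * orient a b c \<ge> 0" using assms(2) by (simp add: z orient_affine)
  moreover have "(1 - u) * orient a b c \<ge> 0"
    using assms(3) by (simp add: z orient_affine orient_rotate)
  ultimately have "0 \<le> u" "u \<le> 1" using assms(1) by (auto simp: zero_le_mult_iff)
  then show ?thesis unfolding closed_segment_def using z by blast
qed

section \<open>Small perturbations of a point\<close>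

lemma orient_step: "orient p q (z + h *\<^sub>R (x - y)) = orient p q z + h * (orient p q x - orient p q y)"
  by (simp add: orient_def algebra_simps)

lemma small_step:
  fixes v :: "'a :: real_normed_vector"
  assumes "e > 0" "c > 0"
  obtains h :: real where "0 < h" "h < c" "h * norm v < e"
proof
  \<comment> \<open>The summand 1 keeps the denominator positive when \<open>v\<close> is
    zero.\<close>
  let ?h = "min (c / 2) (e / (norm v + 1))"
  have pos: "norm v + 1 > 0" by (simp add: add_nonneg_pos)
  show "0 < ?h" "?h < c" using assms pos by auto
  have "?h * norm v \<le> e / (norm v + 1) * norm v" by (intro mult_right_mono) auto
  also have "\<dots> < e" using assms pos by (simp add: field_simps)
  finally show "?h * norm v < e" .
qed

text \<open>A move along the normal of the line, in either direction, changes
  \<open>orient p q\<close> by a multiple of the squared length of \<open>q - p\<close>. This pushes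
  points of an open set off the line.\<close>

lemma orient_perturb:
  assumes "open U" "w \<in> U" "p \<noteq> q"
  shows "\<exists>w'\<in>U. orient p q w' > orient p q w" "\<exists>w'\<in>U. orient p q w' < orient p q w"
proof -
  define n :: "real ^ 2" where "n = vector [p $ 2 - q $ 2, q $ 1 - p $ 1]"
  have step: "orient p q (w + h *\<^sub>R n) = orient p q w + h * ((q $ 1 - p $ 1)\<^sup>2 + (q $ 2 - p $ 2)\<^sup>2)" for h
    by (simp add: orient_def n_def algebra_simps power2_eq_square)
  have pos: "(q $ 1 - p $ 1)\<^sup>2 + (q $ 2 - p $ 2)\<^sup>2 > 0"
    using assms(3) by (auto simp: vec_eq_iff forall_2 sum_power2_gt_zero_iff)
  obtain e where e: "e > 0" "ball w e \<subseteq> U" using assms open_contains_ball by blast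
  obtain h where h: "0 < h" "h < 1" "h * norm n < e" using small_step e(1) zero_less_one by metis
  have "w + h *\<^sub>R n \<in> ball w e" "w + (- h) *\<^sub>R n \<in> ball w e" using h by (auto simp: dist_norm)
  moreover have "orient p q (w + h *\<^sub>R n) > orient p q w" "orient p q (w + (- h) *\<^sub>R n) < orient p q w"
    unfolding step using h pos by (simp_all add: mult_neg_pos)
  ultimately show "\<exists>w'\<in>U. orient p q w' > orient p q w" "\<exists>w'\<in>U. orient p q w' < orient p q w"
    using e by blast+
qed

section \<open>Local and global convexity\<close>

text \<open>\<open>inside P\<close> is a union of components of the complement of \<open>P\<close>.
  The uniqueness proofs use this to carry insideness from a known point to
  \<open>d'\<close>.\<close>

lemma connected_subset_inside:
  assumes "connected C" "C \<inter> P = {}" "x \<in> C" "x \<in> inside P"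
  shows "C \<subseteq> inside P"
proof
  fix y assume "y \<in> C"
  then have "connected_component (- P) x y"
    unfolding connected_component_def using assms by blast
  then show "y \<in> inside P" using assms(4) inside_same_component by blast
qed

lemma inside_subset_convex: 
  fixes P :: "'a :: {real_normed_vector, perfect_space} set"
  assumes "convex T" "P \<subseteq> T" shows "inside P \<subseteq> T"
  using outside_subset_convex[OF assms] inside_Int_outside[of P] by blast

text \<open>Along the segment from \<open>x\<close> to \<open>y\<close>, beyond the first point on the frontier of \<open>K\<close> the
  support condition there is violated.\<close>
lemma locally_supported_imp_convex:
  fixes K :: "'a :: euclidean_space set"
  assumes K: "open K" "connected K"
    and supp: "\<And>z. z \<in> frontier K \<Longrightarrow> \<exists>e>0. \<exists>c. \<forall>w\<in>K \<inter> ball z e. c \<bullet> w > c \<bullet> z"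
  shows "convex K"
proof -
  have "closed_segment x y \<subseteq> K" if xK: "x \<in> K" and yK: "y \<in> K" for x y
  proof -
    \<comment> \<open>The points visible from \<open>x\<close> within \<open>K\<close> form a set
      that is open and closed in the connected set \<open>K\<close>, hence all of it.\<close>
    define A where "A = {y \<in> K. closed_segment x y \<subseteq> K}"
    have opn: "\<exists>e>0. ball y e \<subseteq> A" if "y \<in> A" for y
    proof -
      have "closed_segment x y \<inter> - K = {}" "compact (closed_segment x y)" "closed (- K)"
        using that K unfolding A_def by auto
      then obtain e where e: "e > 0" "\<And>p q. p \<in> closed_segment x y \<Longrightarrow> q \<in> - K \<Longrightarrow> e \<le> dist p q"
        using separate_compact_closed by metis
      have "closed_segment x y' \<subseteq> K" if y': "dist y y' < e" for y'
      proof
        fix q assume "q \<in> closed_segment x y'"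
        then obtain u where u: "q = (1 - u) *\<^sub>R x + u *\<^sub>R y'" "0 \<le> u" "u \<le> 1"
          by (auto simp: closed_segment_def)
        have "dist ((1 - u) *\<^sub>R x + u *\<^sub>R y) q = u * dist y y'"
          using u by (simp add: dist_norm flip: scaleR_diff_right)
        also have "\<dots> \<le> dist y y'" using u by (simp add: mult_left_le_one_le)
        finally show "q \<in> K" using e(2)[of "(1 - u) *\<^sub>R x + u *\<^sub>R y" q] y' u
          by (force simp: closed_segment_def)
      qed
      then have "ball y e \<subseteq> A" unfolding A_def by force
      then show ?thesis using e by blast
    qed
    have "openin (top_of_set K) A"
      unfolding openin_open
      by (rule exI[of _ A]) (use opn in \<open>auto simp: A_def open_contains_ball\<close>)
    moreover have "closedin (top_of_set K) A"
      unfolding closedin_limpt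
    proof (intro conjI allI impI)
      show "A \<subseteq> K" by (auto simp: A_def)
      fix y assume y: "y islimpt A \<and> y \<in> K"
      \<comment> \<open>A limit of segments in \<open>K\<close> lies only in the closure; the
        support condition then brings it back into \<open>K\<close>.\<close>
      have seg: "closed_segment x y \<subseteq> closure K"
      proof -
        obtain s where s: "\<And>n. s n \<in> A" "s \<longlonglongrightarrow> y"
          using y by (meson islimpt_sequential DiffD1)
        have "(1 - u) *\<^sub>R x + u *\<^sub>R y \<in> closure K" if "0 \<le> u" "u \<le> 1" for u
        proof (rule Lim_in_closed_set[OF closed_closure])
          show "((\<lambda>n. (1 - u) *\<^sub>R x + u *\<^sub>R s n) \<longlongrightarrow> (1 - u) *\<^sub>R x + u *\<^sub>R y) sequentially"
            by (intro tendsto_intros s)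
          show "\<forall>\<^sub>F n in sequentially. (1 - u) *\<^sub>R x + u *\<^sub>R s n \<in> closure K"
            using s(1) that closure_subset[of K]
            by (intro always_eventually) (auto simp: A_def closed_segment_def)
        qed auto
        then show ?thesis by (auto simp: closed_segment_def)
      qed
      have "closed_segment x y \<subseteq> K"
      proof (rule ccontr)
        assume "\<not> closed_segment x y \<subseteq> K"
        define g where "g u = (1 - u) *\<^sub>R x + u *\<^sub>R y" for u
        define B where "B = {u \<in> {0..1}. g u \<in> - K}"
        have cg: "continuous_on {0..1} g" unfolding g_def by (intro continuous_intros)
        have "closed B"
          unfolding B_def
          using continuous_closed_preimage[OF cg, of "- K"] K(1)
          by (simp add: vimage_def Int_def conj_commute conj_assoc closed_Compl)
        moreover have "bounded B"
          by (rule bounded_subset[of "{0..1}"]) (auto simp: B_def bounded_closed_interval)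
        ultimately have cB: "compact B" by (simp add: compact_eq_bounded_closed)
        have "B \<noteq> {}" using \<open>\<not> _ \<subseteq> K\<close> by (force simp: B_def g_def closed_segment_def)
        then obtain u where u: "u \<in> B" "\<And>v. v \<in> B \<Longrightarrow> u \<le> v"
          using compact_attains_inf[OF cB] by blast
        have g01: "g 0 \<in> K" "g 1 \<in> K" using xK y by (auto simp: g_def)
        then have u01: "0 < u" "u < 1" using u(1) by (auto simp: B_def less_le)
        have gK: "g v \<in> K" if "0 \<le> v" "v < u" for v
          using u(2)[of v] that u01 by (force simp: B_def)
        have "g u \<in> closure K" using seg u01 by (force simp: g_def closed_segment_def)
        then have "g u \<in> frontier K"
          using u(1) K(1) by (simp add: B_def frontier_def interior_open)
        then obtain e c where ec: "e > 0" "\<And>w. w \<in> K \<Longrightarrow> w \<in> ball (g u) e \<Longrightarrow> c \<bullet> w > c \<bullet> g u"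
          using supp by blast
        have gdiff: "g v - g u = (v - u) *\<^sub>R (y - x)" for v by (simp add: g_def algebra_simps)
        obtain \<delta> where \<delta>: "\<delta> > 0" "\<delta> < u" "\<delta> < 1 - u" and \<delta>n: "\<delta> * norm (y - x) < e"
          using small_step[of e "min u (1 - u)" "y - x"] ec(1) u01 by auto
        have inb: "g v \<in> ball (g u) e" if "\<bar>v - u\<bar> = \<delta>" for v
          using \<delta>n that by (simp add: dist_norm norm_minus_commute[of "g u"] gdiff)
        \<comment> \<open>Up to its first exit parameter \<open>u\<close> the segment runs in
          \<open>K\<close>, so \<open>c\<close> decreases towards \<open>g u\<close> and keeps
          decreasing beyond it. There the segment is still in the closure, so points of
          \<open>K\<close> violate the support condition.\<close>
        have 1: "c \<bullet> g (u - \<delta>) > c \<bullet> g u"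
          using ec(2)[of "g (u - \<delta>)"] gK[of "u - \<delta>"] inb[of "u - \<delta>"] \<delta> by auto
        have "c \<bullet> (g (u - \<delta>) - g u) > 0" using 1 by (simp add: inner_diff_right)
        then have neg: "c \<bullet> (y - x) < 0" using \<delta> by (auto simp: gdiff zero_less_mult_iff mult_less_0_iff)
        have "c \<bullet> (g (u + \<delta>) - g u) < 0" using \<delta> neg by (simp add: gdiff mult_pos_neg)
        then have "g (u + \<delta>) \<in> {w. c \<bullet> w < c \<bullet> g u} \<inter> ball (g u) e"
          using inb[of "u + \<delta>"] \<delta> by (simp add: inner_diff_right)
        moreover have "open ({w. c \<bullet> w < c \<bullet> g u} \<inter> ball (g u) e)"
          by (intro open_Int open_halfspace_lt open_ball)
        moreover have "g (u + \<delta>) \<in> closure K"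
          using seg \<delta> u01 by (force simp: g_def closed_segment_def)
        ultimately obtain w where "w \<in> K" "c \<bullet> w < c \<bullet> g u" "w \<in> ball (g u) e"
          using open_Int_closure_eq_empty[of "{w. c \<bullet> w < c \<bullet> g u} \<inter> ball (g u) e" K] by auto
        then show False using ec(2) by fastforce
      qed
      then show "y \<in> A" using y by (simp add: A_def)
    qed
    moreover have "x \<in> A" using xK by (simp add: A_def)
    ultimately have "A = K" using K(2) unfolding connected_clopen by blast
    then show ?thesis using yK by (auto simp: A_def)
  qed
  then show ?thesis unfolding convex_contains_segment by blast
qed

section \<open>Uniqueness of a reflex vertex\<close>

text \<open>For \<open>orient a b d > 0\<close> the points \<open>z\<close> quantified over fill the larger of the two angles
  that the segments from \<open>d\<close> to \<open>a\<close> and to \<open>b\<close> form.\<close>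
definition reflex_at :: "(real ^ 2) set \<Rightarrow> real ^ 2 \<Rightarrow> real ^ 2 \<Rightarrow> real ^ 2 \<Rightarrow> bool" where
  "reflex_at P a d b \<longleftrightarrow>
    (\<exists>e>0. \<forall>z\<in>ball d e. orient b d z < 0 \<or> orient d a z < 0 \<longrightarrow> z \<in> inside P)"

text \<open>The signs in \<open>s\<close> make the segment from \<open>a\<close> to
  \<open>d'\<close> leave the triangle \<open>a b d\<close> through its side \<open>b d\<close>, at
  a point \<open>x\<close>. A path from the reflex angle at \<open>d\<close> follows the outer face
  of that side back to \<open>x\<close> and then the segment to \<open>d'\<close>.\<close>

lemma reflex_unique_crossing:
  assumes E: "closed E" "b \<in> E"
    and d: "E \<inter> closed_segment d b = {b}"
    and d': "E \<inter> closed_segment a d' = {a}"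
    and pos: "orient a b d > 0" "orient a b d' > 0"
    and s: "orient d a d' > 0" "orient b d d' < 0"
    and reflex: "reflex_at (E \<union> closed_segment a d \<union> closed_segment d b) a d b"
  shows "d' \<in> inside (E \<union> closed_segment a d \<union> closed_segment d b)" (is "_ \<in> inside ?P")
proof -
  obtain e where e: "e > 0"
    "\<And>z. z \<in> ball d e \<Longrightarrow> orient b d z < 0 \<or> orient d a z < 0 \<Longrightarrow> z \<in> inside ?P"
    using reflex unfolding reflex_at_def by blast
  have bda: "orient b d a = orient a b d" by (simp add: orient_rotate)
  \<comment> \<open>The parameter at which \<open>orient b d\<close> vanishes on the segment from
    \<open>a\<close> to \<open>d'\<close>, computed from its values \<open>orient a b d\<close> and
    \<open>orient b d d'\<close> at the ends.\<close>
  define t where "t = orient a b d / (orient a b d - orient b d d')"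
  have t: "0 < t" "t < 1" using pos s by (auto simp: t_def)
  define x where "x = (1 - t) *\<^sub>R a + t *\<^sub>R d'"
  have "t * (orient a b d - orient b d d') = orient a b d" using pos s by (simp add: t_def)
  moreover have "orient b d x = (1 - t) * orient a b d + t * orient b d d'"
    by (simp only: x_def orient_affine bda)
  ultimately have x0: "orient b d x = 0" by (simp add: algebra_simps)
  have x1: "orient a b x > 0" using t pos by (simp add: x_def orient_affine)
  have x2: "orient d a x > 0" using t s by (simp add: x_def orient_affine)
  have "x \<in> closed_segment b d" using triangle_edge[of a b d x] pos x0 x1 x2 by simp
  then have sub: "closed_segment x d \<subseteq> closed_segment d b"
    by (simp add: closed_segment_commute subset_closed_segment)
  have "closed_segment x d \<subseteq> {z. orient a b z > 0}"
    by (intro closed_segment_subset halfplane_gt) (use x1 pos in auto)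
  then have "b \<notin> closed_segment x d" by auto
  moreover have "closed_segment x d \<inter> E \<subseteq> {b}" unfolding d[symmetric] using sub by auto
  ultimately have "closed_segment x d \<inter> E = {}" by auto
  then obtain \<delta> where \<delta>: "\<delta> > 0" "\<And>p q. p \<in> closed_segment x d \<Longrightarrow> q \<in> E \<Longrightarrow> \<delta> \<le> dist p q"
    using separate_compact_closed[of "closed_segment x d" E] E by auto
  \<comment> \<open>A tube around the segment from \<open>x\<close> to \<open>d\<close>, too thin to
    reach \<open>E\<close> and cut off at the line \<open>b d\<close>. The tube is a Minkowski sum
    of convex sets, hence convex.\<close>
  define N where "N = (\<Union>p\<in>closed_segment x d. \<Union>w\<in>ball 0 \<delta>. {p + w}) \<inter> {z. orient b d z < 0}"
  have "convex N" unfolding N_def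
    by (intro convex_Int convex_sums halfplane_lt convex_closed_segment convex_ball)
  then have cN: "connected N" by (rule convex_connected)
  have segs: "closed_segment a d \<union> closed_segment d b \<subseteq> {z. orient b d z \<ge> 0}"
    by (intro Un_least closed_segment_subset halfplane_ge) (use pos bda in auto)
  have "N \<inter> E = {}"
    unfolding N_def using \<delta>(2) by (force simp: dist_norm)
  moreover have "N \<subseteq> {z. orient b d z < 0}" by (auto simp: N_def)
  ultimately have NP: "N \<inter> ?P = {}" using segs by fastforce
  define v where "v = d' - a"
  \<comment> \<open>One small displacement serves twice: it takes \<open>d\<close> into the reflex
    angle and \<open>x\<close> to a point \<open>y\<close> further along the segment to
    \<open>d'\<close>, both within \<open>N\<close>.\<close>
  obtain h where h: "0 < h" "h < 1 - t" "h * norm v < min e \<delta>"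
    using small_step[of "min e \<delta>" "1 - t" v] e \<delta> t by auto
  have ov: "orient b d (p + h *\<^sub>R v) < 0" if "orient b d p = 0" for p
    using that h s pos by (simp add: v_def orient_step bda mult_pos_neg)
  have inN: "p + h *\<^sub>R v \<in> N" if "p \<in> closed_segment x d" "orient b d p = 0" for p
  proof -
    have "h *\<^sub>R v \<in> ball 0 \<delta>" using h by simp
    then have "p + h *\<^sub>R v \<in> (\<Union>p\<in>closed_segment x d. \<Union>w\<in>ball 0 \<delta>. {p + w})"
      using that(1) by blast
    then show ?thesis unfolding N_def using ov[OF that(2)] by simp
  qed
  have "d + h *\<^sub>R v \<in> inside ?P"
    by (rule e(2)) (use h ov[of d] in \<open>auto simp: dist_norm\<close>)
  then have Nin: "N \<subseteq> inside ?P"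
    using connected_subset_inside[OF cN NP] inN[of d] by simp
  define y where "y = x + h *\<^sub>R v"
  have yN: "y \<in> N" using inN[of x] x0 by (simp add: y_def)
  have yeq: "y = (1 - (t + h)) *\<^sub>R a + (t + h) *\<^sub>R d'" by (simp add: y_def x_def v_def algebra_simps)
  have "y \<in> closed_segment a d'" unfolding closed_segment_def
    using h t yeq by (intro CollectI exI[of _ "t + h"]) auto
  then have sub2: "closed_segment y d' \<subseteq> closed_segment a d'" by (simp add: subset_closed_segment)
  have neg: "closed_segment y d' \<subseteq> {z. orient b d z < 0}"
    by (intro closed_segment_subset halfplane_lt) (use s ov[of x] x0 in \<open>auto simp: y_def\<close>)
  have "a \<notin> closed_segment y d'" using neg bda pos by force
  moreover have "closed_segment y d' \<inter> E \<subseteq> {a}" unfolding d'[symmetric] using sub2 by auto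
  ultimately have "closed_segment y d' \<inter> E = {}" by auto
  then have "closed_segment y d' \<inter> ?P = {}" using neg segs by fastforce
  then have "closed_segment y d' \<subseteq> inside ?P"
    using connected_subset_inside[of "closed_segment y d'" ?P y] Nin yN by auto
  then show ?thesis by auto
qed

text \<open>Here \<open>d\<close> lies in the triangle \<open>a b d'\<close>, and the region between
  the two triangles is bounded by the four edges at \<open>d\<close> and \<open>d'\<close>. So
  \<open>E\<close> without its ends lies in this region or avoids it. In the first case the polygon
  through \<open>d'\<close> stays in the triangle \<open>a b d'\<close>, against the reflex angle at
  \<open>d'\<close>; in the second the way from \<open>d\<close> to \<open>d'\<close> is
  free.\<close>

lemma reflex_unique_nested:
  assumes E: "connected (E - {a, b})" "a \<in> E" "b \<in> E"
    and d: "E \<inter> closed_segment a d = {a}" "E \<inter> closed_segment d b = {b}"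
    and d': "E \<inter> closed_segment a d' = {a}" "E \<inter> closed_segment d' b = {b}"
    and pos: "orient a b d > 0" "orient a b d' > 0"
    and s: "orient d a d' < 0" "orient b d d' < 0"
    and reflex: "reflex_at (E \<union> closed_segment a d \<union> closed_segment d b) a d b"
    and reflex': "reflex_at (E \<union> closed_segment a d' \<union> closed_segment d' b) a d' b"
  shows "d' \<in> inside (E \<union> closed_segment a d \<union> closed_segment d b)" (is "_ \<in> inside ?P")
proof -
  obtain e where e: "e > 0"
    "\<And>z. z \<in> ball d e \<Longrightarrow> orient b d z < 0 \<or> orient d a z < 0 \<Longrightarrow> z \<in> inside ?P"
    using reflex unfolding reflex_at_def by blast
  have rot: "orient b d a = orient a b d" "orient b d' a = orient a b d'"
      "orient d a b = orient a b d" "orient d' a b = orient a b d'"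
    using orient_rotate by metis+
  have sw: "orient d' a d = - orient d a d'" "orient b d' d = - orient b d d'"
    by (simp_all add: orient_def algebra_simps)
  define T where "T = {z. orient a b z \<ge> 0} \<inter> {z. orient b d' z \<ge> 0} \<inter> {z. orient d' a z \<ge> 0}"
  define T0 where "T0 = {z. orient a b z > 0} \<inter> {z. orient b d' z > 0} \<inter> {z. orient d' a z > 0}"
  \<comment> \<open>\<open>T\<close> is the closed triangle \<open>a b d'\<close>, and
    \<open>W\<close> is its part that is not strictly left of both \<open>b d\<close> and
    \<open>d a\<close>. The open set \<open>G\<close> differs from \<open>W\<close> only in points
    of the four edges.\<close>
  define W where "W = T \<inter> ({z. orient b d z \<le> 0} \<union> {z. orient d a z \<le> 0})"
  define G where "G = T0 \<inter> ({z. orient b d z < 0} \<union> {z. orient d a z < 0})"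
  have conT: "convex T" unfolding T_def by (intro convex_Int halfplane_ge)
  have clW: "closed W"
    unfolding W_def T_def by (intro closed_Int closed_Un halfplane_ge halfplane_le)
  have opG: "open G"
    unfolding G_def T0_def by (intro open_Int open_Un halfplane_gt halfplane_lt)
  have "z \<in> closed_segment a d \<union> closed_segment d b \<union> closed_segment a d' \<union> closed_segment d' b"
    if "z \<in> W" "z \<notin> G" for z
  proof -
    have zT: "orient a b z \<ge> 0" "orient b d' z \<ge> 0" "orient d' a z \<ge> 0"
      and zd: "orient b d z \<le> 0 \<or> orient d a z \<le> 0"
      using that by (auto simp: W_def T_def)
    consider "orient b d' z = 0" | "orient d' a z = 0" | "orient a b z = 0" | "z \<in> T0"
      using zT unfolding T0_def by fastforce
    then show ?thesis
    proof cases
      case 1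
      then have "z \<in> closed_segment b d'" using triangle_edge[of a b d' z] pos zT by simp
      then show ?thesis by (simp add: closed_segment_commute)
    next
      case 2
      then have "z \<in> closed_segment d' a" using triangle_edge[of b d' a z] pos zT rot by simp
      then show ?thesis by (simp add: closed_segment_commute)
    next
      case 3
      then have "z \<in> closed_segment a b" using triangle_edge[of d' a b z] pos zT rot by simp
      then obtain u where u: "z = (1 - u) *\<^sub>R a + u *\<^sub>R b" "0 \<le> u" "u \<le> 1"
        by (auto simp: closed_segment_def)
      have "(1 - u) * orient a b d \<le> 0 \<or> u * orient a b d \<le> 0"
        using zd by (simp add: u orient_affine rot)
      then have "u = 1 \<or> u = 0" using u pos by (auto simp: mult_le_0_iff)
      then show ?thesis using u by auto
    next
      case 4
      then have ge: "orient b d z \<ge> 0" "orient d a z \<ge> 0" using that(2) by (auto simp: G_def)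
      from zd show ?thesis
      proof
        assume "orient b d z \<le> 0"
        then have "z \<in> closed_segment b d" using triangle_edge[of a b d z] pos zT ge by simp
        then show ?thesis by (simp add: closed_segment_commute)
      next
        assume "orient d a z \<le> 0"
        then have "z \<in> closed_segment d a" using triangle_edge[of b d a z] pos zT ge rot by simp
        then show ?thesis by (simp add: closed_segment_commute)
      qed
    qed
  qed
  then have EGW: "E - {a, b} \<subseteq> G \<union> - W" using d d' by blast
  have "G \<subseteq> W" unfolding G_def W_def T_def T0_def by auto
  then have "E - {a, b} \<subseteq> G \<or> (E - {a, b}) \<inter> W = {}"
    using connectedD[OF E(1) opG, of "- W"] EGW clW by (auto simp: open_Compl)
  moreover have "\<not> E - {a, b} \<subseteq> G"
  proof
    assume EG: "E - {a, b} \<subseteq> G"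
    have abT: "a \<in> T" "b \<in> T" "d' \<in> T" using pos by (auto simp: T_def rot)
    have "E \<subseteq> T" using EG abT \<open>G \<subseteq> W\<close> unfolding W_def by blast
    moreover have "closed_segment a d' \<union> closed_segment d' b \<subseteq> T"
      by (intro Un_least closed_segment_subset conT abT)
    ultimately have insT: "inside (E \<union> closed_segment a d' \<union> closed_segment d' b) \<subseteq> T" (is "inside ?P' \<subseteq> _")
      by (intro inside_subset_convex conT) blast
    obtain e' where e': "e' > 0"
      "\<And>z. z \<in> ball d' e' \<Longrightarrow> orient b d' z < 0 \<or> orient d' a z < 0 \<Longrightarrow> z \<in> inside ?P'"
      using reflex' unfolding reflex_at_def by blast
    obtain h where h: "0 < h" "h < 1" "h * norm (d' - a) < e'" using small_step e'(1) zero_less_one by metis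
    have neg: "orient b d' (d' + h *\<^sub>R (d' - a)) < 0"
      using h pos by (simp add: orient_step rot)
    then have "d' + h *\<^sub>R (d' - a) \<in> inside ?P'"
      by (intro e') (use h in \<open>auto simp: dist_norm\<close>)
    then show False using insT neg by (auto simp: T_def)
  qed
  ultimately have EW: "(E - {a, b}) \<inter> W = {}" by blast
  define f where "f t = (1 - t) *\<^sub>R d + t *\<^sub>R d'" for t
  have sf: "orient d a (f t) < 0" "orient b d (f t) < 0" if "0 < t" for t
    using that s by (auto simp: f_def orient_affine mult_pos_neg)
  obtain h where h: "0 < h" "h < 1" "h * norm (d' - d) < e" using small_step e(1) zero_less_one by metis
  have fh: "f h = d + h *\<^sub>R (d' - d)" by (simp add: f_def algebra_simps)
  have "closed_segment (f h) d' = f ` {h..1}"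
  proof -
    have f1: "d' = f 1" by (simp add: f_def)
    have "closed_segment (f h) (f 1) = f ` closed_segment h 1"
    proof -
      have "closed_segment (f h) (f 1) = {f ((1 - u) * h + u) | u. 0 \<le> u \<and> u \<le> 1}"
        by (auto simp: closed_segment_def f_def algebra_simps)
      also have "\<dots> = f ` closed_segment h 1"
        by (auto simp: closed_segment_def image_def)
      finally show ?thesis .
    qed
    then show ?thesis using h f1 by (simp add: closed_segment_eq_real_ivl)
  qed
  moreover have "f t \<notin> ?P" if t: "h \<le> t" "t \<le> 1" for t
  proof -
    have t0: "0 < t" using h t by simp
    have "f t \<in> W"
      using t t0 sf[OF t0] pos s
      by (auto simp: W_def T_def f_def orient_affine sw intro!: add_nonneg_nonneg mult_nonneg_nonneg
          mult_nonneg_nonpos)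
    moreover have "f t \<noteq> a" "f t \<noteq> b" using sf[OF t0] by auto
    ultimately have "f t \<notin> E" using EW by blast
    moreover have "closed_segment a d \<subseteq> {z. orient d a z \<ge> 0}" "closed_segment d b \<subseteq> {z. orient b d z \<ge> 0}"
      by (intro closed_segment_subset halfplane_ge; simp)+
    ultimately show ?thesis using sf[OF t0] by force
  qed
  ultimately have "closed_segment (f h) d' \<inter> ?P = {}" by fastforce
  moreover have "f h \<in> inside ?P"
    by (rule e(2)) (use h sf[of h] in \<open>auto simp: fh dist_norm\<close>)
  ultimately have "closed_segment (f h) d' \<subseteq> inside ?P"
    using connected_subset_inside[of "closed_segment (f h) d'" ?P "f h"] by auto
  then show ?thesis by auto
qed

text \<open>Exchanging \<open>d\<close> and \<open>d'\<close> reverses both signs in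
  \<open>gp\<close>. Opposite signs give the crossing configuration, equal signs the nested
  one.\<close>

lemma reflex_unique:
  assumes E: "closed E" "connected (E - {a, b})" "a \<in> E" "b \<in> E"
    and d: "E \<inter> closed_segment a d = {a}" "E \<inter> closed_segment d b = {b}"
    and d': "E \<inter> closed_segment a d' = {a}" "E \<inter> closed_segment d' b = {b}"
    and pos: "orient a b d > 0" "orient a b d' > 0"
    and gp: "orient d a d' \<noteq> 0" "orient b d d' \<noteq> 0"
    and reflex: "reflex_at (E \<union> closed_segment a d \<union> closed_segment d b) a d b"
    and reflex': "reflex_at (E \<union> closed_segment a d' \<union> closed_segment d' b) a d' b"
  shows "d' \<in> inside (E \<union> closed_segment a d \<union> closed_segment d b) \<or>
    d \<in> inside (E \<union> closed_segment a d' \<union> closed_segment d' b)"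
proof -
  have sw: "orient d' a d = - orient d a d'" "orient b d' d = - orient b d d'"
    by (simp_all add: orient_def algebra_simps)
  consider "orient d a d' > 0" "orient b d d' < 0" | "orient d a d' < 0" "orient b d d' > 0"
    | "orient d a d' < 0" "orient b d d' < 0" | "orient d a d' > 0" "orient b d d' > 0"
    using gp by linarith
  then show ?thesis
  proof cases
    case 1 then show ?thesis using reflex_unique_crossing[of E b d a d'] assms by blast
  next
    case 2 then show ?thesis using reflex_unique_crossing[of E b d' a d] assms sw by simp
  next
    case 3 then show ?thesis using reflex_unique_nested[of E a b d d'] assms by blast
  next
    case 4 then show ?thesis using reflex_unique_nested[of E a b d' d] assms sw by simp
  qed
qed

section \<open>Simple polygons\<close>

text \<open>As an unordered pair, the ends do not depend on the direction of the edge, so rotation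
  and reversal of a vertex list can be treated alike.\<close>

definition edge_ends :: "(real ^ 2) list \<Rightarrow> nat \<Rightarrow> (real ^ 2) set" where
  "edge_ends vs i = {vs ! i, vs ! (Suc i mod length vs)}"

lemma polygon_edge_hull: "polygon_edge vs i = convex hull (edge_ends vs i)"
  by (simp add: polygon_edge_def edge_ends_def segment_convex_hull)

lemma simple_polygon_ends:
  "simple_polygon vs \<longleftrightarrow> 3 \<le> length vs \<and> distinct vs \<and>
    (\<forall>i<length vs. \<forall>j<length vs. i \<noteq> j \<longrightarrow>
      convex hull (edge_ends vs i) \<inter> convex hull (edge_ends vs j) = edge_ends vs i \<inter> edge_ends vs j)"
  unfolding simple_polygon_def polygon_edge_hull edge_ends_def ..

text \<open>For distinct vertices, simplicity and the boundary depend only on the family of end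
  pairs, not on its indexing.\<close>

lemma polygon_reindex:
  assumes "simple_polygon vs" "length vs' = length vs" "distinct vs'"
    and \<sigma>: "bij_betw \<sigma> {..<length vs} {..<length vs}"
    and ends: "\<And>i. i < length vs \<Longrightarrow> edge_ends vs' i = edge_ends vs (\<sigma> i)"
  shows "simple_polygon vs'" "polygon_boundary vs' = polygon_boundary vs"
proof -
  have \<sigma>lt: "\<sigma> i < length vs" if "i < length vs" for i using \<sigma> that by (auto simp: bij_betw_def)
  have \<sigma>ne: "\<sigma> i \<noteq> \<sigma> j" if "i < length vs" "j < length vs" "i \<noteq> j" for i j
    using \<sigma> that by (auto simp: bij_betw_def inj_on_def)
  show "simple_polygon vs'"
    using assms(1-3) \<sigma>lt \<sigma>ne by (simp add: simple_polygon_ends ends)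
  have "polygon_boundary vs' = (\<Union>i<length vs. polygon_edge vs (\<sigma> i))"
    unfolding polygon_boundary_def by (simp add: assms(2) polygon_edge_hull ends)
  also have "\<dots> = (\<Union>i\<in>\<sigma> ` {..<length vs}. polygon_edge vs i)" by (simp only: image_image)
  finally show "polygon_boundary vs' = polygon_boundary vs"
    unfolding bij_betw_imp_surj_on[OF \<sigma>] polygon_boundary_def .
qed

lemma polygon_rotate1:
  assumes "simple_polygon vs"
  shows "simple_polygon (rotate1 vs) \<and> polygon_boundary (rotate1 vs) = polygon_boundary vs"
proof -
  have m: "length vs > 0" using assms by (auto simp: simple_polygon_def)
  have "inj_on (\<lambda>i. Suc i mod length vs) {..<length vs}"
    by (auto simp: inj_on_def mod_Suc split: if_splits)
  then have "bij_betw (\<lambda>i. Suc i mod length vs) {..<length vs} {..<length vs}"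
    using m by (simp add: bij_betw_def endo_inj_surj image_subset_iff)
  moreover have "edge_ends (rotate1 vs) i = edge_ends vs (Suc i mod length vs)" if "i < length vs" for i
    using that m by (simp add: edge_ends_def nth_rotate1)
  ultimately show ?thesis
    using polygon_reindex[OF assms, of "rotate1 vs"] assms by (simp add: simple_polygon_def)
qed

lemma polygon_rotate:
  assumes "simple_polygon vs"
  shows "simple_polygon (rotate k vs) \<and> polygon_boundary (rotate k vs) = polygon_boundary vs"
  by (induction k) (use assms polygon_rotate1 in auto)

lemma polygon_rev:
  assumes "simple_polygon vs"
  shows "simple_polygon (rev vs) \<and> polygon_boundary (rev vs) = polygon_boundary vs"
proof -
  define m where "m = length vs"
  have m: "m \<ge> 3" using assms by (auto simp: simple_polygon_def m_def)
  \<comment> \<open>Edge \<open>i\<close> of the reversed list joins the old positions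
    \<open>m - 1 - i\<close> and \<open>m - 2 - i\<close>; the closing edge remains the closing
    edge.\<close>
  define \<sigma> where "\<sigma> i = (if Suc i = m then i else m - 2 - i)" for i
  have "inj_on \<sigma> {..<m}" by (auto simp: inj_on_def \<sigma>_def)
  moreover have "\<sigma> ` {..<m} \<subseteq> {..<m}" using m by (auto simp: \<sigma>_def)
  ultimately have "bij_betw \<sigma> {..<m} {..<m}" by (simp add: bij_betw_def endo_inj_surj)
  moreover have "edge_ends (rev vs) i = edge_ends vs (\<sigma> i)" if "i < m" for i
  proof (cases "Suc i = m")
    case True
    then show ?thesis using m by (auto simp: edge_ends_def \<sigma>_def rev_nth m_def[symmetric])
  next
    case False
    then have i: "Suc i < m" using that by simp
    then have "Suc i mod m = Suc i" "Suc (m - 2 - i) mod m = m - Suc i" by auto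
    moreover have "rev vs ! i = vs ! (m - Suc i)" "rev vs ! Suc i = vs ! (m - 2 - i)"
      using i by (simp_all add: rev_nth m_def)
    moreover have "\<sigma> i = m - 2 - i" using False by (simp add: \<sigma>_def)
    ultimately show ?thesis
      by (simp only: edge_ends_def length_rev m_def[symmetric] insert_commute)
  qed
  ultimately show ?thesis
    using polygon_reindex[OF assms, of "rev vs" \<sigma>] assms by (simp add: simple_polygon_def m_def)
qed

text \<open>Swaps the two neighbours of \<open>d\<close> but keeps \<open>d\<close> last, so that
  \<open>orient (last us) (hd us) d\<close> may be assumed positive.\<close>

lemma polygon_rev_snoc:
  assumes "simple_polygon (us @ [d])"
  shows "simple_polygon (rev us @ [d])" "polygon_boundary (rev us @ [d]) = polygon_boundary (us @ [d])"
  using polygon_rev[OF assms] polygon_rotate1[of "rev (us @ [d])"] by auto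

section \<open>Simple polygons as Jordan curves\<close>

lemma polygon_arc:
  assumes "simple_polygon vs" "0 < j" "j < length vs"
  obtains g where "arc g" "path_image g = (\<Union>i<j. polygon_edge vs i)"
    "pathstart g = vs ! 0" "pathfinish g = vs ! j"
proof -
  have dist: "distinct vs" using assms by (simp add: simple_polygon_def)
  have "\<exists>g. arc g \<and> path_image g = (\<Union>i<j. polygon_edge vs i) \<and> pathstart g = vs ! 0 \<and> pathfinish g = vs ! j"
    using assms(2,3)
  proof (induction j)
    case (Suc j)
    have seg: "path_image (linepath (vs ! j) (vs ! Suc j)) = polygon_edge vs j"
      using Suc.prems by (simp add: polygon_edge_def)
    have ne: "vs ! j \<noteq> vs ! Suc j" using dist Suc.prems by (simp add: nth_eq_iff_index_eq)
    show ?case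
    proof (cases "j = 0")
      case True
      then show ?thesis
        by (intro exI[of _ "linepath (vs ! 0) (vs ! 1)"]) (use ne seg in \<open>auto simp: arc_linepath lessThan_Suc\<close>)
    next
      case False
      then obtain g where g: "arc g" "path_image g = (\<Union>i<j. polygon_edge vs i)"
        "pathstart g = vs ! 0" "pathfinish g = vs ! j" using Suc by auto
      \<comment> \<open>The next edge shares only \<open>vs ! j\<close> with the arc so far: the
        vertex \<open>vs ! Suc j\<close> is new, as the closing edge is never reached.\<close>
      have "polygon_edge vs i \<inter> polygon_edge vs j \<subseteq> {vs ! j}" if "i < j" for i
      proof -
        have "polygon_edge vs i \<inter> polygon_edge vs j = {vs ! i, vs ! Suc i} \<inter> {vs ! j, vs ! Suc j}"
          using assms(1) Suc.prems that by (auto simp: simple_polygon_def)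
        moreover have "vs ! i \<noteq> vs ! j" "vs ! i \<noteq> vs ! Suc j" "vs ! Suc i \<noteq> vs ! Suc j"
          using dist Suc.prems that by (simp_all add: nth_eq_iff_index_eq)
        ultimately show ?thesis by auto
      qed
      then have "path_image g \<inter> path_image (linepath (vs ! j) (vs ! Suc j)) \<subseteq> {vs ! j}"
        unfolding seg g(2) by blast
      then have "arc (g +++ linepath (vs ! j) (vs ! Suc j))"
        using g ne by (intro arc_join) (auto simp: arc_linepath)
      then show ?thesis
        using g seg by (intro exI[of _ "g +++ linepath (vs ! j) (vs ! Suc j)"])
          (auto simp: path_image_join lessThan_Suc)
    qed
  qed simp
  then show ?thesis using that by blast
qed

lemma arc_image_Diff_ends_connected:
  assumes "arc g"
  shows "connected (path_image g - {pathstart g, pathfinish g})"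
proof -
  have inj: "inj_on g {0..1}" and cont: "continuous_on {0..1} g"
    using assms by (auto simp: arc_def path_def)
  have "path_image g - {pathstart g, pathfinish g} = g ` {0<..<1}"
  proof
    show "path_image g - {pathstart g, pathfinish g} \<subseteq> g ` {0<..<1}"
    proof
      fix x assume x: "x \<in> path_image g - {pathstart g, pathfinish g}"
      then obtain t where t: "x = g t" "0 \<le> t" "t \<le> 1" by (auto simp: path_image_def)
      then have "t \<noteq> 0" "t \<noteq> 1" using x by (auto simp: pathstart_def pathfinish_def)
      then show "x \<in> g ` {0<..<1}" using t by auto
    qed
    show "g ` {0<..<1} \<subseteq> path_image g - {pathstart g, pathfinish g}"
      using inj by (fastforce simp: path_image_def pathstart_def pathfinish_def inj_on_def)
  qed
  moreover have "connected (g ` {0<..<1::real})"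
    by (intro connected_continuous_image continuous_on_subset[OF cont]) auto
  ultimately show ?thesis by simp
qed

text \<open>The arc through all vertices and the closing edge form a Jordan curve, to which the
  Jordan-Brouwer theorems apply. The inside is nonempty because the complement is disconnected while
  the outside of a bounded set in the plane is connected.\<close>

lemma polygon_components:
  assumes "simple_polygon vs"
  shows "K \<in> components (- polygon_boundary vs) \<Longrightarrow> frontier K = polygon_boundary vs"
    and "inside (polygon_boundary vs) \<noteq> {}" 
    and "compact (polygon_boundary vs)"
proof -
  define m where "m = length vs - 1"
  have m: "m \<ge> 2" "length vs = Suc m" using assms by (auto simp: simple_polygon_def m_def)
  have dist: "distinct vs" using assms by (simp add: simple_polygon_def)
  obtain g where g: "arc g" "path_image g = (\<Union>i<m. polygon_edge vs i)"
    "pathstart g = vs ! 0" "pathfinish g = vs ! m"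
    using polygon_arc[OF assms, of m] m by auto
  have seg: "path_image (linepath (vs ! m) (vs ! 0)) = polygon_edge vs m"
    by (simp add: polygon_edge_def m)
  have ne: "vs ! m \<noteq> vs ! 0" using dist m by (simp add: nth_eq_iff_index_eq)
  have "polygon_edge vs i \<inter> polygon_edge vs m \<subseteq> {vs ! 0, vs ! m}" if "i < m" for i
    using assms m that by (auto simp: simple_polygon_def)
  then have "path_image g \<inter> path_image (linepath (vs ! m) (vs ! 0)) \<subseteq> {vs ! 0, vs ! m}"
    unfolding seg g(2) by blast
  then have sp: "simple_path (g +++ linepath (vs ! m) (vs ! 0))"
    using g ne by (intro simple_path_join_loop) (auto simp: arc_linepath)
  have im: "path_image (g +++ linepath (vs ! m) (vs ! 0)) = polygon_boundary vs"
    using g seg m by (auto simp: path_image_join polygon_boundary_def lessThan_Suc)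
  show cpt: "compact (polygon_boundary vs)"
    using compact_simple_path_image[OF sp] im by simp
  have "polygon_boundary vs homeomorphic sphere (0::complex) 1"
    using homeomorphic_simple_path_image_circle[OF sp] g im by simp
  also have "sphere (0::complex) 1 homeomorphic sphere (0::real ^ 2) 1"
    by (rule homeomorphic_spheres_gen) auto
  finally have hom: "polygon_boundary vs homeomorphic sphere (0::real ^ 2) 1" .
  show "K \<in> components (- polygon_boundary vs) \<Longrightarrow> frontier K = polygon_boundary vs"
    by (rule Jordan_Brouwer_frontier[OF hom]) auto
  have "connected (outside (polygon_boundary vs))"
    using cpt by (intro connected_outside) (auto simp: compact_imp_bounded)
  moreover have "\<not> connected (- polygon_boundary vs)"
    using Jordan_Brouwer_separation[OF hom] by simp
  ultimately show "inside (polygon_boundary vs) \<noteq> {}"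
    using inside_Un_outside[of "polygon_boundary vs"] by (metis sup_bot.left_neutral)
qed

section \<open>Splitting a polygon at its last vertex\<close>

definition polyline :: "(real ^ 2) list \<Rightarrow> (real ^ 2) set" where
  "polyline us = (\<Union>i<length us - 1. closed_segment (us ! i) (us ! Suc i))"

text \<open>Supplies the hypotheses of \<open>reflex_unique\<close>, with \<open>polyline us\<close>
  as the set \<open>E\<close> that all polygons \<open>us @ [d]\<close> have in common.\<close>

lemma polygon_snoc:
  assumes "simple_polygon (us @ [d])"
  defines "a \<equiv> last us" and "b \<equiv> hd us"
  shows "closed (polyline us)" "connected (polyline us - {a, b})"
    "a \<in> polyline us" "b \<in> polyline us" "d \<notin> polyline us"
    "polyline us \<inter> closed_segment a d = {a}" "polyline us \<inter> closed_segment d b = {b}"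
    "closed_segment a d \<inter> closed_segment d b = {d}"
    "polygon_boundary (us @ [d]) = polyline us \<union> closed_segment a d \<union> closed_segment d b"
    "a \<noteq> b" "d \<noteq> a" "d \<noteq> b"
proof -
  define vs where "vs = us @ [d]"
  have sp: "simple_polygon vs" using assms by (simp add: vs_def)
  define n where "n = length us"
  have n: "n \<ge> 2" using assms by (auto simp: simple_polygon_def n_def)
  then have "us \<noteq> []" by (auto simp: n_def)
  have len: "length vs = Suc n" by (simp add: vs_def n_def)
  have v: "vs ! 0 = b" "vs ! (n - 1) = a" "vs ! n = d"
    using \<open>us \<noteq> []\<close> n by (auto simp: vs_def nth_append a_def b_def hd_conv_nth last_conv_nth n_def)
  have usv: "us ! i = vs ! i" if "i < n" for i using that by (simp add: vs_def nth_append n_def)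
  have dist: "distinct vs" using sp by (simp add: simple_polygon_def)
  have neq: "vs ! i \<noteq> vs ! j" if "i \<le> n" "j \<le> n" "i \<noteq> j" for i j
    using that dist len by (simp add: nth_eq_iff_index_eq)
  show "a \<noteq> b" "d \<noteq> a" "d \<noteq> b" using neq[of "n - 1" 0] neq[of n "n - 1"] neq[of n 0] n v by auto
  have e1: "polygon_edge vs (n - 1) = closed_segment a d" using n v by (simp add: polygon_edge_def len)
  have e2: "polygon_edge vs n = closed_segment d b" using v by (simp add: polygon_edge_def len)
  have pl: "polyline us = (\<Union>i<n - 1. polygon_edge vs i)"
    unfolding polyline_def n_def[symmetric]
    by (rule SUP_cong) (use len usv in \<open>auto simp: polygon_edge_def\<close>)
  have "0 < n - 1" "n - 1 < length vs" using n len by auto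
  from polygon_arc[OF sp this] obtain g where g: "arc g" "path_image g = polyline us"
    "pathstart g = b" "pathfinish g = a"
    unfolding v pl by metis
  show "connected (polyline us - {a, b})"
    using arc_image_Diff_ends_connected[OF g(1)] g by (simp add: insert_commute)
  show "closed (polyline us)" using g closed_arc_image by metis
  show ab: "a \<in> polyline us" "b \<in> polyline us" using g pathstart_in_path_image pathfinish_in_path_image by metis+
  have "{..<length vs} = {..<n - 1} \<union> {n - 1, n}" using n len by auto
  then show "polygon_boundary (us @ [d]) = polyline us \<union> closed_segment a d \<union> closed_segment d b"
    unfolding vs_def[symmetric] polygon_boundary_def pl using e1 e2 by auto
  have int: "polygon_edge vs i \<inter> polygon_edge vs j = {vs ! i, vs ! (Suc i mod Suc n)} \<inter> {vs ! j, vs ! (Suc j mod Suc n)}"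
    if "i \<le> n" "j \<le> n" "i \<noteq> j" for i j
    using sp that len by (simp add: simple_polygon_def)
  have S: "Suc (n - 1) mod Suc n = n" "Suc n mod Suc n = 0" using n by auto
  have ne: "a \<noteq> b" "d \<noteq> a" "d \<noteq> b" using neq[of "n - 1" 0] neq[of n "n - 1"] neq[of n 0] n v by auto
  have "closed_segment a d \<inter> closed_segment d b = {a, d} \<inter> {d, b}"
    using int[of "n - 1" n] n unfolding S e1 e2 v by simp
  then show "closed_segment a d \<inter> closed_segment d b = {d}" using ne by auto
  have ad: "polygon_edge vs i \<inter> closed_segment a d \<subseteq> {a}"
    and db: "polygon_edge vs i \<inter> closed_segment d b \<subseteq> {b}" if "i < n - 1" for i
  proof -
    have "polygon_edge vs i \<inter> closed_segment a d = {vs ! i, vs ! Suc i} \<inter> {a, d}"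
      using int[of i "n - 1"] that n unfolding S e1 v by simp
    moreover have "polygon_edge vs i \<inter> closed_segment d b = {vs ! i, vs ! Suc i} \<inter> {d, b}"
      using int[of i n] that n unfolding S e2 v by simp
    moreover have "vs ! i \<noteq> d" "vs ! Suc i \<noteq> d"
      using neq[of i n] neq[of "Suc i" n] that unfolding v by auto
    ultimately show "polygon_edge vs i \<inter> closed_segment a d \<subseteq> {a}"
      "polygon_edge vs i \<inter> closed_segment d b \<subseteq> {b}" by auto
  qed
  show 1: "polyline us \<inter> closed_segment a d = {a}" using ad pl ab by auto
  show "polyline us \<inter> closed_segment d b = {b}" using db pl ab by auto
  show "d \<notin> polyline us" using 1 \<open>d \<noteq> a\<close> by auto
qed

section \<open>Polygons without reflex vertices\<close>

text \<open>Near \<open>d\<close> the larger angle is connected and misses the polygon, so if it met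
  \<open>K\<close>, it would lie in \<open>K\<close> and \<open>d\<close> would be reflex. Hence
  \<open>K\<close> is locally confined to the smaller angle, which is convex.\<close>

lemma vertex_support:
  assumes sp: "simple_polygon (us @ [d])" and pos: "orient (last us) (hd us) d > 0"
    and nr: "\<not> reflex_at (polygon_boundary (us @ [d])) (last us) d (hd us)"
    and K: "K \<in> components (- polygon_boundary (us @ [d]))" "K \<subseteq> inside (polygon_boundary (us @ [d]))"
  shows "\<exists>e>0. \<exists>c. \<forall>w\<in>K \<inter> ball d e. c \<bullet> w > c \<bullet> d"
proof -
  define a where "a = last us"
  define b where "b = hd us"
  define P where "P = polygon_boundary (us @ [d])"
  note S = polygon_snoc[OF sp, folded a_def b_def P_def]
  have rot: "orient b d a = orient a b d" "orient d a b = orient a b d" using orient_rotate by metis+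
  have pos: "orient a b d > 0" using pos by (simp add: a_def b_def)
  obtain e where e: "e > 0" "ball d e \<subseteq> - polyline us"
    using S(1,5) open_contains_ball[of "- polyline us"] by (auto simp: open_Compl)
  define L1 where "L1 = ball d e \<inter> {z. orient b d z < 0}"
  define L2 where "L2 = ball d e \<inter> {z. orient d a z < 0}"
  have con: "connected L1" "connected L2"
    unfolding L1_def L2_def by (intro convex_connected convex_Int convex_ball halfplane_lt)+
  \<comment> \<open>This vector points into the angle vertically opposite to the one spanned by
    \<open>a\<close> and \<open>b\<close>, where the two half-discs overlap.\<close>
  define v where "v = 2 *\<^sub>R d - a - b"
  obtain h where h: "0 < h" "h < 1" "h * norm v < e" using small_step e(1) zero_less_one by metis
  have "orient b d (d + h *\<^sub>R v) = - h * orient b d a" "orient d a (d + h *\<^sub>R v) = - h * orient d a b"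
    by (simp_all add: orient_def v_def algebra_simps)
  then have "orient b d (d + h *\<^sub>R v) < 0" "orient d a (d + h *\<^sub>R v) < 0"
    using h pos by (simp_all add: rot)
  then have "d + h *\<^sub>R v \<in> L1 \<inter> L2" using h by (auto simp: L1_def L2_def dist_norm)
  then have conL: "connected (L1 \<union> L2)" using con by (intro connected_Un) auto
  have "closed_segment a d \<subseteq> {z. orient b d z \<ge> 0} \<inter> {z. orient d a z \<ge> 0}"
      "closed_segment d b \<subseteq> {z. orient b d z \<ge> 0} \<inter> {z. orient d a z \<ge> 0}"
    by (intro closed_segment_subset convex_Int halfplane_ge; use pos in \<open>simp add: rot\<close>)+
  then have LP: "(L1 \<union> L2) \<inter> P = {}"
    using e unfolding S(9) L1_def L2_def by fastforce
  have LK: "(L1 \<union> L2) \<inter> K = {}"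
  proof (rule ccontr)
    assume "(L1 \<union> L2) \<inter> K \<noteq> {}"
    then have "L1 \<union> L2 \<subseteq> K"
      using components_maximal[OF K(1) conL] LP by (auto simp: P_def)
    then have "reflex_at P a d b"
      unfolding reflex_at_def using K(2) e(1) by (auto simp: L1_def L2_def P_def intro!: exI[of _ e])
    then show False using nr by (simp add: P_def a_def b_def)
  qed
  \<comment> \<open>The gradient of \<open>orient b d + orient d a\<close>, a sum of two functions
    that are nonnegative on the angle at \<open>d\<close> and vanish together only at
    \<open>d\<close>.\<close>
  define c :: "real ^ 2" where "c = vector [b $ 2 - a $ 2, a $ 1 - b $ 1]"
  have c: "c \<bullet> w - c \<bullet> d = orient b d w + orient d a w" for w
    by (simp add: c_def orient_def inner_vec_def sum_2 algebra_simps)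
  have "c \<bullet> w > c \<bullet> d" if w: "w \<in> K" "w \<in> ball d e" for w
  proof -
    have ge: "orient b d w \<ge> 0" "orient d a w \<ge> 0" using w LK by (auto simp: L1_def L2_def not_less)
    have "w \<notin> P" using K(1) w in_components_subset by (force simp: P_def)
    then have "w \<noteq> d" using S(9) by auto
    have "orient b d w \<noteq> 0 \<or> orient d a w \<noteq> 0"
    proof (rule ccontr)
      assume 0: "\<not> (orient b d w \<noteq> 0 \<or> orient d a w \<noteq> 0)"
      then obtain u where u: "w = (1 - u) *\<^sub>R b + u *\<^sub>R d"
        using orient_eq_0_line[of b d w] S(12) by metis
      have "(1 - u) * orient a b d = 0" using 0 by (simp add: u orient_affine rot)
      then show False using \<open>w \<noteq> d\<close> u pos by simp
    qed
    then show ?thesis using c[of w] ge by linarith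
  qed
  then show ?thesis using e(1) by blast
qed

text \<open>Near \<open>z\<close> the polygon is just the edge, and each half-disc beside it lies in
  \<open>K\<close> or avoids \<open>K\<close>. As \<open>z\<close> is also on the frontier of the
  outside, one half-disc must avoid \<open>K\<close>.\<close>

lemma edge_support:
  assumes sp: "simple_polygon (us @ [d])"
    and z: "z \<in> closed_segment d (hd us)" "z \<noteq> d" "z \<noteq> hd us"
    and K: "K \<in> components (- polygon_boundary (us @ [d]))" "K \<subseteq> inside (polygon_boundary (us @ [d]))"
  shows "\<exists>e>0. \<exists>c. \<forall>w\<in>K \<inter> ball z e. c \<bullet> w > c \<bullet> z"
proof -
  define a where "a = last us"
  define b where "b = hd us"
  define P where "P = polygon_boundary (us @ [d])"
  note S = polygon_snoc[OF sp, folded a_def b_def P_def]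
  note KP = K[folded P_def] and zb = z[folded b_def]
  have "z \<in> - (polyline us \<union> closed_segment a d)"
    using zb S(7,8) by blast
  moreover have "open (- (polyline us \<union> closed_segment a d))" using S(1) by (intro open_Compl closed_Un) auto
  ultimately obtain e where e: "e > 0" "ball z e \<subseteq> - (polyline us \<union> closed_segment a d)"
    using open_contains_ball by metis
  have cpt: "compact P" using polygon_components(3)[OF sp] by (simp add: P_def)
  have opK: "open K" using KP(1) cpt open_components compact_imp_closed by (metis open_Compl)
  have on_seg: "closed_segment d b \<subseteq> {z. orient b d z \<ge> 0}" "closed_segment d b \<subseteq> {z. orient b d z \<le> 0}"
    by (intro closed_segment_subset halfplane_ge halfplane_le; simp)+
  have z0: "orient b d z = 0" using on_seg zb by force
  define D1 where "D1 = ball z e \<inter> {w. orient b d w > 0}"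
  define D2 where "D2 = ball z e \<inter> {w. orient b d w < 0}"
  have con: "connected D1" "connected D2"
    unfolding D1_def D2_def by (intro convex_connected convex_Int convex_ball halfplane_lt halfplane_gt)+
  have DP: "D1 \<subseteq> - P" "D2 \<subseteq> - P"
    using e(2) on_seg unfolding S(9) D1_def D2_def by fastforce+
  have bP: "bounded P" using cpt by (rule compact_imp_bounded)
  have "connected (outside P)" using bP by (intro connected_outside) auto
  moreover have "outside P \<noteq> {}" using outside_bounded_nonempty bP by blast
  ultimately have "frontier (outside P) = P"
    using polygon_components(1)[OF sp, of "outside P"] outside_in_components[of P] by (simp add: P_def)
  then have "z \<in> closure (outside P)" using S(9) zb by (auto simp: frontier_def)
  then obtain w where w: "w \<in> outside P" "w \<in> ball z e"
    using open_Int_closure_eq_empty[of "ball z e" "outside P"] centre_in_ball[of z e] e(1) by blast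
  have opO: "open (outside P \<inter> ball z e)"
    using cpt by (intro open_Int open_outside compact_imp_closed) auto
  have "d \<noteq> b" using S(12) .
  \<comment> \<open>The point \<open>w\<close> may lie on the line of the edge; a perturbation
    within the open outside moves it off.\<close>
  have "\<exists>w\<in>outside P. w \<in> D1 \<or> w \<in> D2"
  proof (cases "orient b d w \<ge> 0")
    case True
    then obtain w' where "w' \<in> outside P \<inter> ball z e" "orient b d w' > orient b d w"
      using orient_perturb(1)[OF opO, of w b d] w \<open>d \<noteq> b\<close> by auto
    then show ?thesis using True by (auto simp: D1_def)
  qed (use w in \<open>auto simp: D2_def\<close>)
  then have "\<not> D1 \<subseteq> K \<or> \<not> D2 \<subseteq> K" using KP(2) inside_Int_outside[of P] by blast
  then have "D1 \<inter> K = {} \<or> D2 \<inter> K = {}"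
    using components_maximal[OF KP(1) con(1) DP(1)] components_maximal[OF KP(1) con(2) DP(2)] by blast
  then show ?thesis
  proof
    assume D: "D1 \<inter> K = {}"
    \<comment> \<open>Points of \<open>K\<close> on the line are excluded as well: nearby points of
      the open set \<open>K\<close> would fall into \<open>D1\<close>.\<close>
    have lt: "orient b d w < 0" if w: "w \<in> K" "w \<in> ball z e" for w
    proof (rule ccontr)
      assume "\<not> orient b d w < 0"
      moreover obtain w' where "w' \<in> K \<inter> ball z e" "orient b d w' > orient b d w"
        using orient_perturb(1)[of "K \<inter> ball z e" w b d] w opK \<open>d \<noteq> b\<close> by (auto simp: open_Int)
      ultimately show False using D by (auto simp: D1_def)
    qed
    define c :: "real ^ 2" where "c = vector [d $ 2 - b $ 2, b $ 1 - d $ 1]"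
    have c: "c \<bullet> w - c \<bullet> z = orient b d z - orient b d w" for w
      by (simp add: c_def orient_def inner_vec_def sum_2 algebra_simps)
    have "c \<bullet> w > c \<bullet> z" if "w \<in> K \<inter> ball z e" for w using c[of w] lt[of w] that z0 by auto
    then show ?thesis using e(1) by blast
  next
    assume D: "D2 \<inter> K = {}"
    have gt: "orient b d w > 0" if w: "w \<in> K" "w \<in> ball z e" for w
    proof (rule ccontr)
      assume "\<not> orient b d w > 0"
      moreover obtain w' where "w' \<in> K \<inter> ball z e" "orient b d w' < orient b d w"
        using orient_perturb(2)[of "K \<inter> ball z e" w b d] w opK \<open>d \<noteq> b\<close> by (auto simp: open_Int)
      ultimately show False using D by (auto simp: D2_def)
    qed
    define c :: "real ^ 2" where "c = vector [b $ 2 - d $ 2, d $ 1 - b $ 1]"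
    have c: "c \<bullet> w - c \<bullet> z = orient b d w - orient b d z" for w
      by (simp add: c_def orient_def inner_vec_def sum_2 algebra_simps)
    have "c \<bullet> w > c \<bullet> z" if "w \<in> K \<inter> ball z e" for w using c[of w] gt[of w] that z0 by auto
    then show ?thesis using e(1) by blast
  qed
qed

section \<open>Polygons and the convex hull of their vertices\<close>

lemma polygon_boundary_hull:
  assumes "vs \<noteq> []"
  shows "set vs \<subseteq> polygon_boundary vs" "polygon_boundary vs \<subseteq> convex hull (set vs)"
proof -
  show "set vs \<subseteq> polygon_boundary vs"
    by (force simp: polygon_boundary_def polygon_edge_def in_set_conv_nth)
  have "edge_ends vs i \<subseteq> set vs" if "i < length vs" for i
    using that assms by (auto simp: edge_ends_def)
  then show "polygon_boundary vs \<subseteq> convex hull (set vs)"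
    unfolding polygon_boundary_def polygon_edge_hull by (blast dest: hull_mono[of _ _ convex])
qed

lemma inside_polygon_hull:
  assumes "vs \<noteq> []"
  shows "inside (polygon_boundary vs) \<subseteq> convex hull (set vs)"
  using polygon_boundary_hull[OF assms] by (intro inside_subset_convex) auto

text \<open>Without a reflex vertex, a component \<open>K\<close> of the inside is supported at
  every frontier point, hence convex, and must be the interior of the hull of the vertices. Rotation
  and reversal allow the reflex vertex to be last with positive orientation.\<close>

lemma polygon_reflex_or_convex:
  assumes sp: "simple_polygon vs"
    and gp: "general_position (set vs)"
  obtains (reflex) us d where "simple_polygon (us @ [d])" "polygon_boundary (us @ [d]) = polygon_boundary vs"
      "set (us @ [d]) = set vs" "orient (last us) (hd us) d > 0"
      "reflex_at (polygon_boundary (us @ [d])) (last us) d (hd us)"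
  | (convex) "interior (convex hull (set vs)) \<subseteq> inside (polygon_boundary vs)"
      "polygon_boundary vs = frontier (interior (convex hull (set vs)))"
proof -
  define P where "P = polygon_boundary vs"
  define m where "m = length vs"
  have m: "m \<ge> 3" and dist: "distinct vs" using sp by (auto simp: simple_polygon_def m_def)
  obtain x where x: "x \<in> inside P" using polygon_components(2)[OF sp] by (auto simp: P_def)
  define K where "K = connected_component_set (- P) x"
  have KC: "K \<in> components (- P)"
    unfolding K_def using x by (intro componentsI) (use inside_no_overlap[of P] in blast)
  have KI: "K \<subseteq> inside P" unfolding K_def using inside_same_component x by blast
  have fr: "frontier K = P" using polygon_components(1)[OF sp] KC by (simp add: P_def)
  have cpt: "compact P" using polygon_components(3)[OF sp] by (simp add: P_def)
  have opK: "open K" using KC cpt open_components compact_imp_closed by (metis open_Compl)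
  have conK: "connected K" using KC in_components_connected by blast
  show ?thesis
  proof (cases "\<exists>us d. simple_polygon (us @ [d]) \<and> polygon_boundary (us @ [d]) = P \<and>
      set (us @ [d]) = set vs \<and> orient (last us) (hd us) d > 0 \<and> reflex_at P (last us) d (hd us)")
    case True
    then show ?thesis using reflex by (auto simp: P_def)
  next
    case False
    have "\<exists>e>0. \<exists>c. \<forall>w\<in>K \<inter> ball z e. c \<bullet> w > c \<bullet> z" if "z \<in> frontier K" for z
    proof -
      have "z \<in> P" using that fr by simp
      then obtain j where j: "j < m" "z \<in> polygon_edge vs j" by (auto simp: P_def polygon_boundary_def m_def)
      \<comment> \<open>The edge is chosen such that \<open>z\<close> is not its second end; a
        vertex is thus always met as a first end.\<close>
      obtain i where i: "i < m" "z \<in> polygon_edge vs i" "z \<noteq> vs ! (Suc i mod m)"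
      proof (cases "z = vs ! (Suc j mod m)")
        case True
        have "Suc (Suc j mod m) mod m \<noteq> Suc j mod m" using j m by (auto simp: mod_Suc)
        then have "vs ! (Suc (Suc j mod m) mod m) \<noteq> vs ! (Suc j mod m)"
          using dist m by (simp add: m_def nth_eq_iff_index_eq flip: length_greater_0_conv)
        moreover have "Suc j mod m < m" using m by simp
        ultimately show ?thesis using True that[of "Suc j mod m"]
          by (simp add: polygon_edge_def flip: m_def)
      qed (use j that in blast)
      \<comment> \<open>After this rotation, edge \<open>i\<close> is the closing edge, from
        \<open>d\<close> to \<open>hd us\<close>.\<close>
      define ws where "ws = rotate (Suc i) vs"
      have ws: "simple_polygon ws" "polygon_boundary ws = P" "set ws = set vs" "length ws = m"
        using polygon_rotate[OF sp, of "Suc i"] by (auto simp: ws_def P_def m_def)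
      have "ws \<noteq> []" using ws(4) m by auto
      define us where "us = butlast ws"
      define d where "d = last ws"
      have wsd: "ws = us @ [d]" using \<open>ws \<noteq> []\<close> by (simp add: us_def d_def)
      have "us \<noteq> []" using wsd ws(4) m by (cases us) auto
      have "d = ws ! (m - 1)" using \<open>ws \<noteq> []\<close> ws(4) by (simp add: d_def last_conv_nth)
      also have "\<dots> = vs ! ((Suc i + (m - 1)) mod m)"
        using m by (simp only: ws_def nth_rotate m_def[symmetric])
      also have "Suc i + (m - 1) = i + m" using m by simp
      finally have d: "d = vs ! i" using i by simp
      have "hd us = ws ! 0" using wsd \<open>us \<noteq> []\<close> by (simp add: hd_conv_nth nth_append)
      also have "\<dots> = vs ! ((Suc i + 0) mod m)"
        unfolding ws_def m_def by (rule nth_rotate) (use m in \<open>auto simp: m_def\<close>)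
      also have "\<dots> = vs ! (Suc i mod m)" by simp
      finally have b: "hd us = vs ! (Suc i mod m)" .
      have z: "z \<in> closed_segment d (hd us)" "z \<noteq> hd us"
        using i by (simp_all add: d b polygon_edge_def m_def)
      have sp': "simple_polygon (us @ [d])" and Pd: "polygon_boundary (us @ [d]) = P"
        and setd: "set (us @ [d]) = set vs" using ws wsd by auto
      note KC' = KC[folded Pd] and KI' = KI[folded Pd]
      show ?thesis
      proof (cases "z = d")
        case zd: True
        have "last us \<in> set us" "hd us \<in> set us" using \<open>us \<noteq> []\<close> by auto
        then have "orient (last us) (hd us) d \<noteq> 0"
          using general_position_orient[OF gp, of "last us" "hd us" d] polygon_snoc(10-12)[OF sp'] setd by auto
        then consider "orient (last us) (hd us) d > 0" | "orient (hd us) (last us) d > 0"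
          using orient_swap[of "hd us" "last us" d] by linarith
        then show ?thesis
        proof cases
          case 1
          then have "\<not> reflex_at (polygon_boundary (us @ [d])) (last us) d (hd us)"
            using False sp' setd by (auto simp: Pd)
          then show ?thesis using vertex_support[OF sp' 1 _ KC' KI'] zd by simp
        next
          case 2
          note R = polygon_rev_snoc[OF sp']
          have lr: "last (rev us) = hd us" "hd (rev us) = last us"
            using \<open>us \<noteq> []\<close> by (auto simp: last_rev hd_rev)
          have 2: "orient (last (rev us)) (hd (rev us)) d > 0" using 2 lr by simp
          then have "\<not> reflex_at (polygon_boundary (rev us @ [d])) (last (rev us)) d (hd (rev us))"
            using False R setd by (auto simp: Pd)
          then show ?thesis
            using vertex_support[OF R(1) 2] zd KC KI by (simp add: R(2) Pd)
        qed
      qed (use edge_support[OF sp' z(1) _ z(2) KC' KI'] in simp)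
    qed
    then have cvx: "convex K" using locally_supported_imp_convex[OF opK conK] by blast
    have "vs \<noteq> []" using m by (auto simp: m_def)
    note H = polygon_boundary_hull[OF this, folded P_def]
    have "set vs \<subseteq> closure K" using H(1) fr by (auto simp: frontier_def)
    then have "convex hull (set vs) \<subseteq> closure K" by (simp add: hull_minimal cvx convex_closure)
    \<comment> \<open>The open convex set \<open>K\<close> is the interior of its closure.\<close>
    then have 1: "interior (convex hull (set vs)) \<subseteq> K"
      using convex_interior_closure[OF cvx] interior_mono opK by (metis interior_open)
    have "K \<subseteq> convex hull (set vs)"
      using KI inside_polygon_hull[OF \<open>vs \<noteq> []\<close>] by (auto simp: P_def)
    then have "K \<subseteq> interior (convex hull (set vs))" using opK by (simp add: interior_maximal)
    with 1 have "interior (convex hull (set vs)) = K" by blast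
    then show ?thesis using convex KI fr unfolding P_def by metis
  qed
qed

text \<open>At \<open>d\<close> the hull of all vertices fills an angle larger than a straight one,
  which leaves no supporting line. An interior point is not extreme, so dropping \<open>d\<close>
  does not shrink the hull.\<close>

lemma reflex_in_interior_hull:
  assumes sp: "simple_polygon (us @ [d])" and pos: "orient (last us) (hd us) d > 0"
    and reflex: "reflex_at (polygon_boundary (us @ [d])) (last us) d (hd us)"
  shows "d \<in> interior (convex hull (set us))"
proof -
  define a where "a = last us"
  define b where "b = hd us"
  define H where "H = convex hull (set (us @ [d]))"
  have rot: "orient b d a = orient a b d" "orient d a b = orient a b d" using orient_rotate by metis+
  have pos: "orient a b d > 0" using pos by (simp add: a_def b_def)
  define P where "P = polygon_boundary (us @ [d])"
  have "open (inside P)"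
    unfolding P_def by (intro open_inside compact_imp_closed polygon_components(3)[OF sp])
  then have PH: "inside P \<subseteq> interior H"
    using inside_polygon_hull[of "us @ [d]"] by (simp add: interior_maximal P_def H_def)
  obtain e where e: "e > 0"
    "\<And>z. z \<in> ball d e \<Longrightarrow> orient b d z < 0 \<or> orient d a z < 0 \<Longrightarrow> z \<in> interior H"
    using reflex PH unfolding reflex_at_def P_def a_def b_def by blast
  have "d \<in> interior H"
  proof (rule ccontr)
    assume nd: "d \<notin> interior H"
    have "convex (interior H)" by (simp add: H_def convex_interior)
    moreover have "interior H \<noteq> {}" using PH polygon_components(2)[OF sp] by (auto simp: P_def)
    ultimately obtain c where c: "c \<noteq> 0" "\<And>y. y \<in> interior H \<Longrightarrow> c \<bullet> d \<le> c \<bullet> y"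
      using separating_hyperplane_sets[of "{d}" "interior H"] nd by force
    \<comment> \<open>Directions into the reflex angle have nonnegative inner product with
      \<open>c\<close>. The ones chosen below force \<open>c\<close> to be orthogonal first to
      \<open>a - b\<close> and then to \<open>a - d\<close>.\<close>
    have le: "c \<bullet> v \<ge> 0" if v: "\<And>h. h > 0 \<Longrightarrow> orient b d (d + h *\<^sub>R v) < 0 \<or> orient d a (d + h *\<^sub>R v) < 0" for v
    proof -
      obtain h where h: "0 < h" "h < 1" "h * norm v < e" using small_step e(1) zero_less_one by metis
      have "d + h *\<^sub>R v \<in> interior H" using e(2)[of "d + h *\<^sub>R v"] v[OF h(1)] h by (auto simp: dist_norm)
      then show ?thesis using c(2)[of "d + h *\<^sub>R v"] h by (simp add: inner_add_right zero_le_mult_iff)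
    qed
    have st: "orient b d (d + h *\<^sub>R (d - a)) = - h * orient a b d" 
      "orient d a (d + h *\<^sub>R (d - b)) = - h * orient a b d"
      "orient b d (d + h *\<^sub>R (a - b)) = h * orient a b d"
      "orient d a (d + h *\<^sub>R (a - b)) = - h * orient a b d"
      "orient b d (d + h *\<^sub>R (b - a)) = - h * orient a b d" for h
      by (simp_all add: orient_def algebra_simps)
    have da: "c \<bullet> (d - a) \<ge> 0" "c \<bullet> (d - b) \<ge> 0" "c \<bullet> (a - b) \<ge> 0" "c \<bullet> (b - a) \<ge> 0"
      by (intro le; use pos st in simp)+
    then have ab: "c \<bullet> (a - b) = 0" by (simp add: inner_diff_right)
    have st': "orient b d (d + h *\<^sub>R ((a - d) + s *\<^sub>R (a - b))) = h * (1 + s) * orient a b d"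
         "orient d a (d + h *\<^sub>R ((a - d) + s *\<^sub>R (a - b))) = - h * s * orient a b d" for h s
      by (simp_all add: orient_def algebra_simps)
    have "c \<bullet> ((a - d) + 1 *\<^sub>R (a - b)) \<ge> 0"
      by (intro le) (use pos st'[where s = 1] in simp)
    then have "c \<bullet> (a - d) \<ge> 0" using ab by (simp only: inner_add_right scaleR_one add_0_right)
    then have "c \<bullet> (d - a) = 0" using da by (simp add: inner_diff_right)
    with ab have 0: "c \<bullet> (a - d) = 0" "c \<bullet> (b - d) = 0" by (auto simp: inner_diff_right)
    \<comment> \<open>Cramer's rule: \<open>a - d\<close> and \<open>b - d\<close> have determinant
      \<open>orient a b d\<close>, so \<open>c\<close> vanishes.\<close>
    have "c $ 1 * orient a b d = 0" "c $ 2 * orient a b d = 0"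
      using 0 by (simp_all add: orient_def inner_vec_def sum_2) algebra+
    then show False using c(1) pos by (auto simp: vec_eq_iff forall_2)
  qed
  moreover have "d \<in> convex hull (set us)"
  proof (rule ccontr)
    assume "d \<notin> convex hull (set us)"
    then have "d extreme_point_of H"
      using extreme_point_of_convex_hull_insert[of "set us" d] by (simp add: H_def)
    then show False using \<open>d \<in> interior H\<close> extreme_point_not_in_interior by blast
  qed
  then have "H = convex hull (set us)" by (simp add: H_def hull_redundant)
  ultimately show ?thesis by simp
qed

section \<open>Points in convex position\<close>

text \<open>The barycentric coordinates of \<open>z\<close> are the signed areas of the three
  subtriangles divided by the area of the whole.\<close>

lemma in_triangle:
  assumes "orient a b c > 0" "orient a b z \<ge> 0" "orient b c z \<ge> 0" "orient c a z \<ge> 0"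
  shows "z \<in> convex hull {a, b, c}"
proof -
  define D where "D = orient a b c"
  have "orient b c z + orient c a z + orient a b z = D"
    by (simp add: D_def orient_def algebra_simps)
  then have sum: "orient b c z / D + orient c a z / D + orient a b z / D = 1"
    using assms(1) by (simp add: D_def flip: add_divide_distrib)
  have "D *\<^sub>R z = orient b c z *\<^sub>R a + orient c a z *\<^sub>R b + orient a b z *\<^sub>R c"
    by (simp add: D_def vec_eq_iff forall_2 orient_def algebra_simps)
  then have "(1 / D) *\<^sub>R (D *\<^sub>R z) =
      (1 / D) *\<^sub>R (orient b c z *\<^sub>R a + orient c a z *\<^sub>R b + orient a b z *\<^sub>R c)" by simp
  then have "z = (orient b c z / D) *\<^sub>R a + (orient c a z / D) *\<^sub>R b + (orient a b z / D) *\<^sub>R c"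
    using assms(1) by (simp add: D_def scaleR_right_distrib)
  moreover have "0 \<le> orient b c z / D" "0 \<le> orient c a z / D" "0 \<le> orient a b z / D"
    using assms by (auto simp: D_def)
  ultimately show ?thesis
    unfolding convex_hull_3 using sum by blast
qed

lemma convex_position_not_in_hull:
  assumes "convex_position T" "p \<in> T" "A \<subseteq> T" "p \<notin> A"
  shows "p \<notin> convex hull A"
proof -
  have "convex hull A \<subseteq> convex hull (T - {p})" using assms by (intro hull_mono) auto
  then show ?thesis using assms by (auto simp: convex_position_def)
qed

lemma convex_position_subset:
  assumes "convex_position T" "U \<subseteq> T"
  shows "convex_position U"
  unfolding convex_position_def
proof
  fix p assume "p \<in> U"
  then show "p \<notin> convex hull (U - {p})"
    by (intro convex_position_not_in_hull[OF assms(1)]) (use assms(2) in auto)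
qed

lemma convex_position_imp_general:
  assumes "convex_position T"
  shows "general_position T"
  unfolding general_position_def
proof (intro ballI impI notI)
  fix a b c assume T: "a \<in> T" "b \<in> T" "c \<in> T" and ne: "a \<noteq> b \<and> a \<noteq> c \<and> b \<noteq> c"
    and col: "collinear {a, b, c}"
  have "a \<notin> convex hull {b, c}" "b \<notin> convex hull {c, a}" "c \<notin> convex hull {a, b}"
    by (rule convex_position_not_in_hull[OF assms]; use T ne in auto)+
  then show False
    using col unfolding collinear_between_cases between_mem_segment segment_convex_hull by blast
qed

text \<open>The position of two edges of a convex polygon: as \<open>r\<close> and \<open>s\<close>
  are not both ends of \<open>p q\<close>, the segment from \<open>r\<close> to \<open>s\<close>
  touches the line of \<open>p q\<close> at most in a common end.\<close>

lemma segments_meet: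
  assumes "r \<in> {p, q} \<or> orient p q r > 0" "s \<in> {p, q} \<or> orient p q s > 0" "\<not> (r \<in> {p, q} \<and> s \<in> {p, q})"
  shows "closed_segment p q \<inter> closed_segment r s = {p, q} \<inter> {r, s}"
proof -
  have pq: "closed_segment p q \<subseteq> {z. orient p q z \<le> 0}"
    by (intro closed_segment_subset halfplane_le) auto
  have one: "closed_segment p q \<inter> closed_segment x y = {p, q} \<inter> {x, y}"
    if x: "x \<in> {p, q}" and y: "orient p q y > 0" for x y
  proof -
    have "w = x" if w: "w \<in> closed_segment p q" "w \<in> closed_segment x y" for w
    proof -
      obtain u where u: "w = (1 - u) *\<^sub>R x + u *\<^sub>R y" "0 \<le> u" "u \<le> 1"
        using w by (auto simp: closed_segment_def)
      have "u * orient p q y \<le> 0" using pq w(1) x by (auto simp: u orient_affine)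
      then have "u = 0" using u y by (simp add: mult_le_0_iff)
      then show ?thesis using u by simp
    qed
    moreover have "x \<in> closed_segment p q" using x by auto
    moreover have "y \<noteq> p" "y \<noteq> q" using y by auto
    ultimately show ?thesis using x by auto
  qed
  consider "r \<in> {p, q}" "orient p q s > 0" | "s \<in> {p, q}" "orient p q r > 0"
    | "orient p q r > 0" "orient p q s > 0" using assms by blast
  then show ?thesis
  proof cases
    case 1 then show ?thesis using one by blast
  next
    case 2
    then show ?thesis using one[of s r] by (simp add: closed_segment_commute insert_commute)
  next
    case 3
    then have "closed_segment r s \<subseteq> {z. orient p q z > 0}"
      by (intro closed_segment_subset halfplane_gt) auto
    moreover have "r \<notin> {p, q}" "s \<notin> {p, q}" using 3 by auto
    ultimately show ?thesis using pq by fastforce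
  qed
qed

text \<open>The orientation hypothesis describes a convex polygon listed counterclockwise. Each edge
  then has all other vertices strictly to its left, and \<open>segments_meet\<close>
  applies.\<close>

lemma simple_polygon_of_orient:
  assumes m: "length vs \<ge> 3" and dist: "distinct vs"
    and pos: "\<And>i j l. i < j \<Longrightarrow> j < l \<Longrightarrow> l < length vs \<Longrightarrow> orient (vs ! i) (vs ! j) (vs ! l) > 0"
  shows "simple_polygon vs"
proof -
  define m where "m = length vs"
  have m3: "m \<ge> 3" using m by (simp add: m_def)
  have left: "vs ! l \<in> {vs ! i, vs ! (Suc i mod m)} \<or> orient (vs ! i) (vs ! (Suc i mod m)) (vs ! l) > 0"
    if "i < m" "l < m" for i l
  proof (cases "Suc i = m")
    case True
    then have "l = i \<or> l = 0 \<or> (0 < l \<and> l < i)" using that by auto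
    then show ?thesis
      using True pos[of 0 l i] that orient_rotate[of "vs ! 0" "vs ! l" "vs ! i"] by (auto simp: m_def)
  next
    case False
    then have "Suc i mod m = Suc i" "l = i \<or> l = Suc i \<or> l < i \<or> Suc i < l" using that by auto
    then show ?thesis
      using False pos[of l i "Suc i"] pos[of i "Suc i" l] that
        orient_rotate[of "vs ! i" "vs ! Suc i" "vs ! l"] by (auto simp: m_def)
  qed
  have "polygon_edge vs i \<inter> polygon_edge vs j = {vs ! i, vs ! (Suc i mod m)} \<inter> {vs ! j, vs ! (Suc j mod m)}"
    if ij: "i < m" "j < m" "i \<noteq> j" for i j
  proof -
    have idx: "(vs ! x = vs ! y) = (x = y)" if "x < m" "y < m" for x y
      using that dist by (simp add: nth_eq_iff_index_eq m_def)
    have lt: "Suc i mod m < m" "Suc j mod m < m" using m3 by auto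
    have "\<not> ((j = i \<or> j = Suc i mod m) \<and> (Suc j mod m = i \<or> Suc j mod m = Suc i mod m))"
      using ij m3 by (auto simp: mod_Suc split: if_splits)
    then have "\<not> (vs ! j \<in> {vs ! i, vs ! (Suc i mod m)} \<and> vs ! (Suc j mod m) \<in> {vs ! i, vs ! (Suc i mod m)})"
      using ij lt by (simp add: idx)
    then show ?thesis
      using segments_meet[OF left[OF ij(1,2)] left[OF ij(1) lt(2)]]
      by (simp add: polygon_edge_def m_def)
  qed
  then show ?thesis using m dist by (simp add: simple_polygon_def m_def)
qed

text \<open>The points are sorted by their angle at one of them.\<close>
lemma convex_position_simple_polygon:
  assumes fin: "finite T" and card: "card T \<ge> 3" and cp: "convex_position T"
  obtains vs where "simple_polygon vs" "set vs = T"
proof -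
  have gp: "orient a b c \<noteq> 0" if "a \<in> T" "b \<in> T" "c \<in> T" "a \<noteq> b" "a \<noteq> c" "b \<noteq> c" for a b c
    using general_position_orient[OF convex_position_imp_general[OF cp]] that by blast
  have "T \<noteq> {}" using card by auto
  then obtain q where q: "q \<in> T" by blast
  have "q \<notin> convex hull (T - {q})" using cp q by (simp add: convex_position_def)
  moreover have "closed (convex hull (T - {q}))"
    using fin by (intro compact_imp_closed compact_convex_hull finite_imp_compact) auto
  \<comment> \<open>A line separates \<open>q\<close> from the other points, so seen from
    \<open>q\<close> they lie in an open half-plane and can be sorted by angle.\<close>
  ultimately obtain c \<beta> where c: "c \<bullet> q < \<beta>" "\<And>x. x \<in> convex hull (T - {q}) \<Longrightarrow> c \<bullet> x > \<beta>"
    using separating_hyperplane_closed_point[of "convex hull (T - {q})" q] by (auto simp: convex_convex_hull)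
  have cpos: "c \<bullet> (x - q) > 0" if "x \<in> T" "x \<noteq> q" for x
    using c(1) c(2)[of x] that by (simp add: inner_diff_right hull_inc)
  \<comment> \<open>\<open>e\<close> is \<open>c\<close> turned by a right angle, so
    \<open>ang x\<close> is the tangent of the angle from \<open>c\<close> to
    \<open>x - q\<close>.\<close>
  define e :: "real ^ 2" where "e = vector [- c $ 2, c $ 1]"
  define ang where "ang x = (e \<bullet> (x - q)) / (c \<bullet> (x - q))" for x
  have orient_ang: "orient q x y > 0" if xy: "x \<in> T" "y \<in> T" "x \<noteq> q" "y \<noteq> q" "x \<noteq> y" "ang x \<le> ang y" for x y
  proof -
    have "(e \<bullet> (x - q)) * (c \<bullet> (y - q)) \<le> (e \<bullet> (y - q)) * (c \<bullet> (x - q))"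
      using xy(6) cpos xy by (simp add: ang_def divide_le_eq pos_le_divide_eq mult.commute)
    moreover have "(e \<bullet> (y - q)) * (c \<bullet> (x - q)) - (e \<bullet> (x - q)) * (c \<bullet> (y - q)) = (c \<bullet> c) * orient q x y"
      by (simp add: orient_def e_def inner_vec_def sum_2 algebra_simps)
    ultimately have "(c \<bullet> c) * orient q x y \<ge> 0" by linarith
    moreover have "c \<noteq> 0" using cpos[of x] xy by auto
    then have "c \<bullet> c > 0" by simp
    ultimately have "orient q x y \<ge> 0" by (simp only: zero_le_mult_iff) linarith
    then show ?thesis using gp[of q x y] q xy by force
  qed
  obtain l where l: "set l = T - {q}" "distinct l" using finite_distinct_list[of "T - {q}"] fin by auto
  define xs where "xs = sort_key ang l"
  have xs: "set xs = T - {q}" "distinct xs" "sorted (map ang xs)" using l by (auto simp: xs_def)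
  define vs where "vs = q # xs"
  have vs: "set vs = T" "distinct vs" using xs q by (auto simp: vs_def)
  have o1: "orient (vs ! 0) (vs ! j) (vs ! k) > 0" if jk: "0 < j" "j < k" "k < length vs" for j k
  proof -
    have mem: "xs ! (j - 1) \<in> set xs" "xs ! (k - 1) \<in> set xs" using jk by (auto simp: vs_def)
    have "xs ! (j - 1) \<noteq> xs ! (k - 1)" using jk xs(2) by (simp add: nth_eq_iff_index_eq vs_def)
    moreover have "ang (xs ! (j - 1)) \<le> ang (xs ! (k - 1))"
      using sorted_nth_mono[OF xs(3), of "j - 1" "k - 1"] jk by (simp add: vs_def)
    ultimately have "orient q (xs ! (j - 1)) (xs ! (k - 1)) > 0"
      using orient_ang mem xs(1) by auto
    then show ?thesis using jk by (simp add: vs_def nth_Cons')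
  qed
  have "orient (vs ! i) (vs ! j) (vs ! k) > 0" if ijk: "i < j" "j < k" "k < length vs" for i j k
  proof (cases "i = 0")
    case False
    have memT: "vs ! l \<in> T" if "l < length vs" for l using nth_mem[OF that] vs(1) by simp
    have T: "vs ! i \<in> T" "vs ! j \<in> T" "vs ! k \<in> T" "vs ! 0 \<in> T" 
      by (rule memT; use ijk in linarith)+
    have ne: "vs ! i \<noteq> vs ! j" "vs ! i \<noteq> vs ! k" "vs ! j \<noteq> vs ! k" "vs ! 0 \<noteq> vs ! j"
      by (subst nth_eq_iff_index_eq[OF vs(2)]; use ijk False in linarith)+
    have p: "orient (vs ! 0) (vs ! i) (vs ! j) > 0" "orient (vs ! 0) (vs ! j) (vs ! k) > 0"
      "orient (vs ! 0) (vs ! i) (vs ! k) > 0" using o1 ijk False by auto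
    show ?thesis
    proof (rule ccontr)
      \<comment> \<open>With the wrong orientation, \<open>vs ! j\<close> would fall into the
        triangle of \<open>vs ! 0\<close>, \<open>vs ! i\<close> and \<open>vs ! k\<close>.\<close>
      assume "\<not> ?thesis"
      then have "orient (vs ! i) (vs ! k) (vs ! j) > 0"
        using gp[OF T(1-3) ne(1-3)] by (simp add: orient_def algebra_simps)
      moreover have "orient (vs ! k) (vs ! 0) (vs ! j) > 0" using p(2) orient_rotate by metis
      ultimately have "vs ! j \<in> convex hull {vs ! 0, vs ! i, vs ! k}"
        using in_triangle[of "vs ! 0" "vs ! i" "vs ! k" "vs ! j"] p by auto
      moreover have "vs ! j \<notin> convex hull {vs ! 0, vs ! i, vs ! k}"
        by (rule convex_position_not_in_hull[OF cp T(2)]) (use T ne in auto)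
      ultimately show False by blast
    qed
  qed (use o1 ijk in simp)
  then have "simple_polygon vs"
    using vs card distinct_card[of vs] by (intro simple_polygon_of_orient) auto
  then show ?thesis using that vs by blast
qed

section \<open>Holes of sets in convex position\<close>

lemma finite_k_holes:
  assumes "finite S"
  shows "finite (k_holes k S)"
proof -
  have "k_holes k S \<subseteq> polygon_boundary ` {vs. set vs \<subseteq> S \<and> length vs = k}"
    by (auto simp: k_holes_def k_gons_def)
  then show ?thesis by (rule finite_subset) (intro finite_imageI finite_lists_length_eq assms)
qed

text \<open>Every \<open>k\<close>-subset carries a simple polygon, whose inside stays in the hull
  of the subset and so contains no other point of \<open>C\<close>. Different subsets give different
  polygons, since each subset consists of the extreme points of its hull.\<close>

lemma convex_position_holes:
  assumes fin: "finite C" and cp: "convex_position C" and k: "k \<ge> 3"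
  shows "card C choose k \<le> card (k_holes k C)"
proof -
  define \<T> where "\<T> = {T. T \<subseteq> C \<and> card T = k}"
  have "\<exists>vs. simple_polygon vs \<and> set vs = T" if "T \<in> \<T>" for T
  proof -
    have "finite T" "card T \<ge> 3" "convex_position T"
      using that fin k convex_position_subset[OF cp] by (auto simp: \<T>_def finite_subset)
    then show ?thesis using convex_position_simple_polygon by metis
  qed
  then obtain f where f: "\<And>T. T \<in> \<T> \<Longrightarrow> simple_polygon (f T) \<and> set (f T) = T" by metis
  have hull: "convex hull (polygon_boundary (f T)) = convex hull T" and ne: "f T \<noteq> []" if T: "T \<in> \<T>" for T
  proof -
    show "f T \<noteq> []" using f[OF T] by (auto simp: simple_polygon_def)
    note B = polygon_boundary_hull[OF this]
    show "convex hull (polygon_boundary (f T)) = convex hull T"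
      using B f[OF T] by (metis convex_convex_hull hull_minimal hull_mono subset_antisym)
  qed
  have "inj_on (\<lambda>T. polygon_boundary (f T)) \<T>"
  proof (rule inj_onI)
    fix T U assume TU: "T \<in> \<T>" "U \<in> \<T>" "polygon_boundary (f T) = polygon_boundary (f U)"
    have ext: "x extreme_point_of convex hull V \<longleftrightarrow> x \<in> V" if "V \<in> \<T>" for x V
    proof (rule extreme_point_of_convex_hull_convex_independent)
      show "compact V" using that fin by (auto simp: \<T>_def intro: finite_imp_compact finite_subset)
      show "a \<notin> convex hull (V - {a})" if "a \<in> V" for a
        using that \<open>V \<in> \<T>\<close> convex_position_subset[OF cp, of V] by (auto simp: \<T>_def convex_position_def)
    qed
    have "convex hull T = convex hull U" using hull TU by metis
    then have "x \<in> T \<longleftrightarrow> x \<in> U" for x using ext[OF TU(1), of x] ext[OF TU(2), of x] by simp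
    then show "T = U" by blast
  qed
  moreover have "polygon_boundary (f T) \<in> k_holes k C" if T: "T \<in> \<T>" for T
  proof -
    have TC: "T \<subseteq> C" "card T = k" using T by (auto simp: \<T>_def)
    have "length (f T) = k" using f[OF T] TC distinct_card by (metis simple_polygon_def)
    then have "polygon_boundary (f T) \<in> k_gons k C"
      using f[OF T] TC unfolding k_gons_def by blast
    moreover have "s \<notin> C" if s: "s \<in> inside (polygon_boundary (f T))" for s
    proof
      assume "s \<in> C"
      have "s \<notin> T" using s f[OF T] polygon_boundary_hull(1)[OF ne[OF T]] inside_no_overlap by blast
      moreover have "s \<in> convex hull T" using s inside_polygon_hull[OF ne[OF T]] f[OF T] by auto
      ultimately show False using convex_position_not_in_hull[OF cp \<open>s \<in> C\<close> TC(1)] by blast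
    qed
    ultimately show ?thesis by (auto simp: k_holes_def)
  qed
  ultimately have "card \<T> \<le> card (k_holes k C)"
    using finite_k_holes[OF fin] by (intro card_inj_on_le) auto
  then show ?thesis by (simp add: \<T>_def n_subsets[OF fin])
qed

lemma convex_position_exists:
  obtains C where "finite C" "card C = n" "convex_position C"
proof -
  define p :: "nat \<Rightarrow> real ^ 2" where "p i = vector [real i, (real i)\<^sup>2]" for i
  have inj: "inj p" by (auto simp: inj_def p_def vec_eq_iff forall_2)
  have "convex_position (p ` {..<n})"
    unfolding convex_position_def
  proof
    fix x assume "x \<in> p ` {..<n}"
    then obtain i where i: "x = p i" by blast
    \<comment> \<open>A normal vector of the tangent to the parabola at \<open>p i\<close>, so that
      \<open>p i\<close> alone minimizes \<open>c\<close> among the points.\<close>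
    define c :: "real ^ 2" where "c = vector [- 2 * real i, 1]"
    have c: "c \<bullet> p j = (real j - real i)\<^sup>2 - (real i)\<^sup>2" for j
      by (simp add: c_def p_def inner_vec_def sum_2 power2_eq_square algebra_simps)
    have "p ` {..<n} - {x} \<subseteq> {y. c \<bullet> y > - (real i)\<^sup>2}"
      using i by (auto simp: c)
    then have "convex hull (p ` {..<n} - {x}) \<subseteq> {y. c \<bullet> y > - (real i)\<^sup>2}"
      by (intro hull_minimal convex_halfspace_gt)
    then show "x \<notin> convex hull (p ` {..<n} - {x})" using c[of i] i by auto
  qed
  then show ?thesis using that[of "p ` {..<n}"] inj by (simp add: card_image inj_on_subset)
qed

section \<open>Counting holes\<close>

text \<open>The bad sets of the introductory text. The point of \<open>S\<close> may belong to
  \<open>W\<close> itself, and supersets of bad sets are bad.\<close>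

definition spans_interior_point :: "(real ^ 2) set \<Rightarrow> (real ^ 2) set \<Rightarrow> bool" where
  "spans_interior_point S W \<longleftrightarrow> interior (convex hull W) \<inter> S \<noteq> {}"

text \<open>The list \<open>us\<close> is the cyclic order with its gap between
  \<open>last us\<close> and \<open>hd us\<close>. The positive orientation selects one side of the
  gap; the other side belongs to \<open>rev us\<close>.\<close>

definition reflex_hole :: "(real ^ 2) set \<Rightarrow> (real ^ 2) list \<Rightarrow> (real ^ 2) set \<Rightarrow> bool" where
  "reflex_hole S us P \<longleftrightarrow> (\<exists>d. simple_polygon (us @ [d]) \<and> P = polygon_boundary (us @ [d]) \<and>
    set (us @ [d]) \<subseteq> S \<and> inside P \<inter> S = {} \<and> orient (last us) (hd us) d > 0 \<and>
    reflex_at P (last us) d (hd us))"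

text \<open>Makes \<open>us\<close> a code for the hole: for two candidates \<open>d\<close> and
  \<open>d'\<close>, \<open>reflex_unique\<close> puts one of these points of \<open>S\<close>
  inside the polygon through the other, which is a hole.\<close>

lemma reflex_hole_unique:
  assumes gp: "general_position S" and P: "reflex_hole S us P" and P': "reflex_hole S us P'"
  shows "P = P'"
proof -
  define a where "a = last us"
  define b where "b = hd us"
  obtain d where d: "simple_polygon (us @ [d])" "P = polygon_boundary (us @ [d])"
    "set (us @ [d]) \<subseteq> S" "inside P \<inter> S = {}" "orient a b d > 0" "reflex_at P a d b"
    using P unfolding reflex_hole_def a_def b_def by blast
  obtain d' where d': "simple_polygon (us @ [d'])" "P' = polygon_boundary (us @ [d'])"
    "set (us @ [d']) \<subseteq> S" "inside P' \<inter> S = {}" "orient a b d' > 0" "reflex_at P' a d' b"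
    using P' unfolding reflex_hole_def a_def b_def by blast
  note D = polygon_snoc[OF d(1), folded a_def b_def d(2)]
  note D' = polygon_snoc[OF d'(1), folded a_def b_def d'(2)]
  have "us \<noteq> []" using d(1) by (auto simp: simple_polygon_def)
  then have abS: "a \<in> S" "b \<in> S" "d \<in> S" "d' \<in> S" using d(3) d'(3) by (auto simp: a_def b_def)
  have "d = d'"
  proof (rule ccontr)
    assume "d \<noteq> d'"
    then have ne: "orient d a d' \<noteq> 0" "orient b d d' \<noteq> 0"
      using general_position_orient[OF gp] abS D(11,12) D'(11,12) by metis+
    have "d' \<in> inside P \<or> d \<in> inside P'"
      using reflex_unique[OF D(1-4) D(6,7) D'(6,7) d(5) d'(5) ne] d(6) d'(6) D(9) D'(9) by simp
    then show False using d(4) d'(4) abS by blast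
  qed
  then show ?thesis using d(2) d'(2) by simp
qed

text \<open>Assigns each hole a code, either a set that is not bad or an ordering of a bad one with
  \<open>k - 1\<close> points. For \<open>k = 4\<close> the list \<open>us\<close> is a triangle
  with the reflex vertex in its interior, which fixes the orientation of \<open>us\<close>.\<close>

lemma k_holes_cases:
  assumes gp: "general_position S" and P: "P \<in> k_holes k S"
  obtains (convex) T where "T \<subseteq> S" "card T = k" "\<not> spans_interior_point S T"
      "P = frontier (interior (convex hull T))"
    | (reflex) us where "reflex_hole S us P" "length us = k - 1" "distinct us" "set us \<subseteq> S"
      "spans_interior_point S (set us)"
      "k = 4 \<Longrightarrow> orient (last us) (hd us) (us ! 1) > 0"
proof -
  obtain vs where vs: "simple_polygon vs" "P = polygon_boundary vs" "length vs = k" "set vs \<subseteq> S"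
    and hole: "inside P \<inter> S = {}"
    using P unfolding k_holes_def k_gons_def by blast
  have dist: "distinct vs" using vs(1) by (simp add: simple_polygon_def)
  have "general_position (set vs)"
    using gp vs(4) unfolding general_position_def by blast
  with vs(1) show ?thesis
  proof (cases rule: polygon_reflex_or_convex)
    case (reflex us d)
    have dist': "distinct (us @ [d])" using reflex(1) by (simp add: simple_polygon_def)
    have "length (us @ [d]) = k"
      using dist dist' reflex(3) vs(3) by (metis distinct_card)
    then have len: "length us = k - 1" by simp
    have di: "d \<in> interior (convex hull (set us))"
      using reflex_in_interior_hull reflex by blast
    have S: "set (us @ [d]) \<subseteq> S" using reflex(3) vs(4) by simp
    have "orient (last us) (hd us) (us ! 1) > 0" if "k = 4"
    proof (rule ccontr)
      assume neg: "\<not> ?thesis"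
      have "length us = 3" using len that by simp
      then obtain u v w where us: "us = [u, v, w]" by (auto simp: length_Suc_conv numeral_3_eq_3)
      have "convex hull (set us) \<subseteq> {z. orient w u z \<le> 0}"
        using neg us by (intro hull_minimal halfplane_le) auto
      then have "orient w u d \<le> 0" using di interior_subset by blast
      then show False using reflex(4) us by simp
    qed
    moreover have "reflex_hole S us P"
      unfolding reflex_hole_def using reflex S vs(2) hole by (intro exI[of _ d]) simp
    moreover have "spans_interior_point S (set us)"
      using di S by (auto simp: spans_interior_point_def)
    ultimately show ?thesis using that(2)[of us] len dist' S by auto
  next
    case convex
    then have "\<not> spans_interior_point S (set vs)"
      using hole vs(2) by (auto simp: spans_interior_point_def)
    then show ?thesis using that(1)[of "set vs"] convex vs dist distinct_card by metis
  qed
qed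

section \<open>Double counting and the upper bound\<close>

lemma le_choose_4: "5 \<le> k \<Longrightarrow> k \<le> k choose 4"
proof (induction k rule: nat_induct_at_least)
  case base
  show ?case by (simp add: eval_nat_numeral)
next
  case (Suc k)
  have "k choose 3 > 0" using Suc by simp
  moreover have "Suc k choose 4 = (k choose 3) + (k choose 4)" by (simp add: eval_nat_numeral)
  ultimately show ?case using Suc by linarith
qed

text \<open>A \<open>k\<close>-set that spans an interior point contains at most \<open>k\<close> of the \<open>(k - 1)\<close>-sets that do,
  while each of those lies in \<open>n - k + 1\<close> such \<open>k\<close>-sets.\<close>
lemma card_spanning_sets:
  assumes fin: "finite S" and k: "k \<ge> 1"
  shows "card {W. W \<subseteq> S \<and> card W = k - 1 \<and> spans_interior_point S W} * (card S - (k - 1)) \<le>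
    k * card {V. V \<subseteq> S \<and> card V = k \<and> spans_interior_point S V}" (is "card ?U * _ \<le> k * card ?B")
proof -
  have finU: "finite ?U" "finite ?B" using fin by (auto intro: finite_subset[of _ "Pow S"])
  have sub: "finite W" if "W \<subseteq> S" for W using that fin finite_subset by blast
  have "card (SIGMA W:?U. S - W) = (\<Sum>W\<in>?U. card (S - W))"
    by (rule card_SigmaI) (use finU fin in auto)
  also have "\<dots> = (\<Sum>W\<in>?U. card S - (k - 1))"
    by (rule sum.cong) (auto simp: card_Diff_subset sub)
  finally have 1: "card (SIGMA W:?U. S - W) = card ?U * (card S - (k - 1))" by simp
  have "card (SIGMA V:?B. V) = (\<Sum>V\<in>?B. card V)"
    by (rule card_SigmaI) (use finU sub in auto)
  then have 2: "card (SIGMA V:?B. V) = k * card ?B" by simp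
  have "card (SIGMA W:?U. S - W) \<le> card (SIGMA V:?B. V)"
  proof (rule card_inj_on_le)
    \<comment> \<open>Recording the added point \<open>x\<close> makes the step from
      \<open>W\<close> to \<open>insert x W\<close> reversible.\<close>
    show "inj_on (\<lambda>(W, x). (insert x W, x)) (SIGMA W:?U. S - W)"
      by (rule inj_onI) (clarsimp, metis insert_ident)
    show "(\<lambda>(W, x). (insert x W, x)) ` (SIGMA W:?U. S - W) \<subseteq> (SIGMA V:?B. V)"
    proof clarsimp
      fix W x assume W: "W \<subseteq> S" "card W = k - Suc 0" "spans_interior_point S W" "x \<in> S" "x \<notin> W"
      have "interior (convex hull W) \<subseteq> interior (convex hull (insert x W))"
        by (intro interior_mono hull_mono) auto
      then show "card (insert x W) = k \<and> spans_interior_point S (insert x W)"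
        using W k sub[OF W(1)] by (auto simp: spans_interior_point_def)
    qed
    show "finite (SIGMA V:?B. V)" using finU sub by (intro finite_SigmaI) auto
  qed
  then show ?thesis using 1 2 by simp
qed

lemma card_k_holes_le:
  assumes k: "k \<ge> 4" and n: "card S \<ge> 2 * fact (k - 1) * (k choose 4) + k - 1"
    and fin: "finite S" and gp: "general_position S"
  shows "card (k_holes k S) \<le> card S choose k"
proof -
  define \<B> where "\<B> = {V. V \<subseteq> S \<and> card V = k \<and> spans_interior_point S V}"
  define \<G> where "\<G> = {V. V \<subseteq> S \<and> card V = k \<and> \<not> spans_interior_point S V}"
  define \<U> where "\<U> = {W. W \<subseteq> S \<and> card W = k - 1 \<and> spans_interior_point S W}"
  define L where "L = {us. distinct us \<and> set us \<in> \<U>}"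
  \<comment> \<open>The codes that can occur. For \<open>k = 4\<close> the orientation admits at
    most one of a list and its reversal.\<close>
  define A where "A = {us \<in> L. k = 4 \<longrightarrow> orient (last us) (hd us) (us ! 1) > 0}"
  have sub: "finite W" if "W \<subseteq> S" for W using that fin finite_subset by blast
  have finBGU: "finite \<B>" "finite \<G>" "finite \<U>"
    unfolding \<B>_def \<G>_def \<U>_def using fin by (auto intro: finite_subset[of _ "Pow S"])
  have L: "L = (\<Union>W\<in>\<U>. permutations_of_set W)" by (auto simp: L_def permutations_of_set_def)
  have finL: "finite L" unfolding L using finBGU by auto
  have "card L \<le> (\<Sum>W\<in>\<U>. card (permutations_of_set W))"
    unfolding L by (rule card_UN_le) (use finBGU in auto)
  also have "\<dots> = (\<Sum>W\<in>\<U>. fact (k - 1))"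
    by (rule sum.cong) (auto simp: \<U>_def sub)
  finally have cardL: "card L \<le> card \<U> * fact (k - 1)" by simp
  have AL: "A \<subseteq> L" by (auto simp: A_def)
  have finA: "finite A" using finL AL finite_subset by blast
  have cardA: "card A \<le> card L" using finL AL card_mono by blast
  have cardA4: "2 * card A \<le> card L" if k4: "k = 4"
  proof -
    have A3: "\<exists>u v w. us = [u, v, w]" if "us \<in> A" for us
    proof -
      have "length us = 3" using that k4 distinct_card[of us] by (auto simp: A_def L_def \<U>_def)
      then show ?thesis by (auto simp: length_Suc_conv numeral_3_eq_3)
    qed
    have "A \<inter> rev ` A = {}"
    proof (rule ccontr)
      assume "A \<inter> rev ` A \<noteq> {}"
      then obtain us where us: "us \<in> A" "rev us \<in> A" by auto
      obtain u v w where "us = [u, v, w]" using A3[OF us(1)] by blast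
      then have "orient w u v > 0" "orient u w v > 0" using us k4 by (auto simp: A_def)
      then show False using orient_swap[of u w v] by simp
    qed
    moreover have "A \<union> rev ` A \<subseteq> L" using AL by (auto simp: L_def)
    moreover have "card (rev ` A) = card A" by (intro card_image) auto
    ultimately show ?thesis
      using card_Un_disjoint[of A "rev ` A"] finA card_mono[OF finL, of "A \<union> rev ` A"] by simp
  qed
  define N where "N = card S - (k - 1)"
  have N: "N \<ge> 2 * fact (k - 1) * (k choose 4)" using n k by (simp add: N_def)
  have Npos: "N > 0"
  proof -
    have "0 < 2 * fact (k - 1) * (k choose 4)" using k by simp
    then show ?thesis using N by linarith
  qed
  have UB: "card \<U> * N \<le> k * card \<B>"
    using card_spanning_sets[OF fin, of k] k by (simp add: \<U>_def \<B>_def N_def)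
  have "2 * card A * N \<le> 2 * N * card \<B>"
  proof (cases "k = 4")
    \<comment> \<open>Here \<open>k \<le> k choose 4\<close> fails and \<open>N\<close> is only
      known to be at least 12. The halved number of orderings makes up for it, as
      \<open>6 * 4 = 2 * 12\<close>.\<close>
    case True
    have "(4::nat) choose 4 = 1" by simp
    then have "N \<ge> 12" using N True by (simp add: fact_numeral)
    have "card L \<le> 6 * card \<U>" using cardL True by (simp add: fact_numeral)
    then have "2 * card A \<le> 6 * card \<U>" using cardA4[OF True] by linarith
    then have "2 * card A * N \<le> 6 * (card \<U> * N)" using mult_le_mono1 by (metis mult.assoc)
    also have "\<dots> \<le> 6 * (4 * card \<B>)" using mult_le_mono2[OF UB, of 6] unfolding True .
    also have "\<dots> \<le> 2 * N * card \<B>" using mult_le_mono1[OF \<open>N \<ge> 12\<close>, of "2 * card \<B>"] by simp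
    finally show ?thesis .
  next
    case False
    then have "k \<le> k choose 4" using k by (intro le_choose_4) simp
    then have "fact (k - 1) * k \<le> fact (k - 1) * (k choose 4)" by simp
    then have kN: "fact (k - 1) * k \<le> N" using N by linarith
    have "card A * N \<le> card \<U> * fact (k - 1) * N" using cardA cardL by (intro mult_le_mono1) linarith
    also have "\<dots> = fact (k - 1) * (card \<U> * N)" by simp
    also have "\<dots> \<le> fact (k - 1) * (k * card \<B>)" using UB by (intro mult_le_mono2)
    also have "\<dots> \<le> N * card \<B>" using mult_le_mono1[OF kN, of "card \<B>"] by (simp add: mult.assoc)
    finally show ?thesis by simp
  qed
  then have AB: "card A \<le> card \<B>" using Npos by simp
  \<comment> \<open>On codes of holes the description is well defined by
    \<open>reflex_hole_unique\<close>; on other lists its value is arbitrary and can only enlarge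
    the image.\<close>
  have "k_holes k S \<subseteq> (\<lambda>T. frontier (interior (convex hull T))) ` \<G> \<union> (\<lambda>us. THE P. reflex_hole S us P) ` A"
  proof
    fix P assume "P \<in> k_holes k S"
    with gp show "P \<in> (\<lambda>T. frontier (interior (convex hull T))) ` \<G> \<union> (\<lambda>us. THE P. reflex_hole S us P) ` A"
    proof (cases rule: k_holes_cases)
      case (convex T)
      then show ?thesis by (auto simp: \<G>_def)
    next
      case (reflex us)
      have "(THE P. reflex_hole S us P) = P"
        using reflex_hole_unique[OF gp _ reflex(1)] by (intro the_equality reflex(1))
      moreover have "us \<in> A" using reflex distinct_card[of us] by (auto simp: A_def L_def \<U>_def)
      ultimately show ?thesis by blast
    qed
  qed
  then have "card (k_holes k S) \<le> card ((\<lambda>T. frontier (interior (convex hull T))) ` \<G> \<union> (\<lambda>us. THE P. reflex_hole S us P) ` A)"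
    using finBGU finA by (intro card_mono) auto
  also have "\<dots> \<le> card \<G> + card A"
    by (rule order_trans[OF card_Un_le]) (intro add_mono card_image_le finBGU finA)
  also have "\<dots> \<le> card \<G> + card \<B>" using AB by simp
  also have "\<dots> = card (\<G> \<union> \<B>)"
    using finBGU by (intro card_Un_disjoint[symmetric]) (auto simp: \<G>_def \<B>_def)
  also have "\<G> \<union> \<B> = {V. V \<subseteq> S \<and> card V = k}" by (auto simp: \<G>_def \<B>_def)
  also have "card \<dots> = card S choose k" by (rule n_subsets[OF fin])
  finally show ?thesis .
qed

text \<open>Sets in convex position attain the bound of the first clause, which gives the third; the
  second shows that the third is not vacuous.\<close>

theorem theorem1:
  fixes k n :: nat
  assumes "k \<ge> 4"
    and "n \<ge> 2 * fact (k - 1) * (k choose 4) + k - 1"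
  shows "(\<forall>S. finite S \<and> card S = n \<and> general_position S \<longrightarrow> card (k_holes k S) \<le> n choose k) \<and>
    (\<exists>C. finite C \<and> card C = n \<and> convex_position C) \<and>
    (\<forall>C. finite C \<and> card C = n \<and> convex_position C \<longrightarrow>
      is_arg_max (\<lambda>S. card (k_holes k S))
        (\<lambda>S. finite S \<and> card S = n \<and> general_position S) C)"
proof (intro conjI allI impI)
  have le: "card (k_holes k S) \<le> n choose k" if "finite S \<and> card S = n \<and> general_position S" for S
    using card_k_holes_le[of k S] assms that by blast
  show "card (k_holes k S) \<le> n choose k" if "finite S \<and> card S = n \<and> general_position S" for S
    using le[OF that] .
  show "\<exists>C. finite C \<and> card C = n \<and> convex_position C"
    using convex_position_exists by metis
  fix C :: "(real ^ 2) set" assume C: "finite C \<and> card C = n \<and> convex_position C"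
  then have "n choose k \<le> card (k_holes k C)"
    using convex_position_holes[of C k] assms(1) by simp
  moreover have "general_position C" using C convex_position_imp_general by blast
  ultimately show "is_arg_max (\<lambda>S. card (k_holes k S))
      (\<lambda>S. finite S \<and> card S = n \<and> general_position S) C"
    using C le unfolding is_arg_max_def by (meson leD le_less_trans order_trans)
qed

end
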